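(* Let $D_f$ be an $f$-divergence with $f$ strictly convex, let $p$ be an elliptically symmetric density on $\mathbb{R}^d$ with point of even symmetry $\mu$ and scatter matrix $M$, and let $\mathcal{Q}=\{q_{\nu,S}\}$ be an elliptical location-scale family with location parameter $\nu$ and scale parameter $S$. Suppose that $p$ is strictly unimodal and that its radial function $g_p$ is differentiable everywhere and strictly radially decreasing in its tail. Suppose also that every $q\in\mathcal{Q}$ is strictly unimodal and has a radial function $g_q$ which is everywhere continuous. Then any stationary point of $(\nu,S)\mapsto D_f(p\|q_{\nu,S})$ with respect to the location-scale parameters $(\nu,S)$ satisfies $\nu=\mu$ and $S=\gamma^2M$ for some $\gamma>0$.
   Context: **$f$-divergence.** For probability densities $p,q$ (w.r.t. Lebesgue measure, strictly positive on $\mathbb{R}^d$), $D_f(p\|q)=\int f\left(\frac{p(z)}{q(z)}\right)q(z)\,dz$, where $f:[0,\infty)\to\mathbb{R}\cup\{+\infty\}$ is finite on $(0,\infty)$, convex, $f(1)=0$, and $\lim_{u\to0^+}f(u)=f(0)$. It is assumed that $f$ is differentiable on $(0,\infty)$. **Elliptical symmetry.** A density $p$ on $\mathbb{R}^d$ is elliptically symmetric about $\mu$ if there is a positive-definite matrix $M$ with $\mathrm{trace}(M)=d$ (the scatter matrix) such that $p(z)=p(z')$ whenever $(z-\mu)^\top M^{-1}(z-\mu)=(z'-\mu)^\top M^{-1}(z'-\mu)$. Equivalently, for any matrix $C$ with $C^\top C=M^{-1}$, $p(z)=g_p(\|C(z-\mu)\|)\,|C|$ for a function $g_p:[0,\infty)\to[0,\infty)$,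 the radial function of $p$ ($|C|$ is the absolute value of the determinant). The point $\mu$ is the point of even symmetry. **Strictly unimodal.** An elliptical density is strictly unimodal if its radial function is strictly decreasing. **Strictly radially decreasing in tail.** $g_p$ is strictly radially decreasing in its tail if there is $R>0$ such that $r\mapsto g_p(r)r^d$ is strictly decreasing for $r>R$. **Elliptical location-scale family.** $\mathcal{Q}=\{q_{\nu,S}:\nu\in\mathbb{R}^d,\ S \text{ symmetric positive-definite}\}$ with $q_{\nu,S}(z)=g_q(\|C(z-\nu)\|)\,|C|$ for any $C$ with $C^\top C=S^{-1}$, where $g_q$ is a fixed radial function not depending on $(\nu,S)$. A stationary point is a $(\nu,S)$ at which the gradient of $D_f(p\|q_{\nu,S})$ with respect to $\nu\in\mathbb{R}^d$ and to $S$ (in the space of symmetric matrices) vanishes. **Standing regularity assumptions.** $p$ is differentiable, $D_f(p\|q)$ is finite for each $q\in\mathcal{Q}$, and differentiation with respect to the variational parameters can be interchanged with integration: writing $S=BB^\top$ with $B$ invertible and $$D_f(p\|q_{\nu,S})=\int f\left(\frac{p(\nu+B\zeta)\,|B|}{g_q(\|\zeta\|)}\right)g_q(\|\zeta\|)\,d\zeta,$$ the partial derivatives of the integrand with respect to $(\nu,B)$ are, locally in $(\nu,B)$, dominated by an integrable function of $\zeta$. *)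

theory Defs
  imports "HOL-Analysis.Analysis"
begin

definition prob_density :: "(real^'n \<Rightarrow> real) \<Rightarrow> bool" where
  "prob_density p \<longleftrightarrow> (\<forall>z. 0 < p z) \<and> has_bochner_integral lborel p 1"

definition pos_def :: "real^'n^'n \<Rightarrow> bool" where
  "pos_def A \<longleftrightarrow> transpose A = A \<and> (\<forall>x. x \<noteq> 0 \<longrightarrow> 0 < x \<bullet> (A *v x))"

text \<open>
  A generator has domain \<open>[0, \<infinity>)\<close> and may take the value \<open>\<infinity>\<close> at 0 only; its values at
  negative arguments are irrelevant.
\<close>

definition f_generator :: "(real \<Rightarrow> ereal) \<Rightarrow> bool" where
  "f_generator f \<longleftrightarrow>
     (\<forall>u>0. \<bar>f u\<bar> \<noteq> \<infinity>) \<and> f 0 \<noteq> - \<infinity> \<and>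
     (\<forall>x\<ge>0. \<forall>y\<ge>0. \<forall>t\<in>{0<..<1}.
        f ((1 - t) * x + t * y) \<le> ereal (1 - t) * f x + ereal t * f y) \<and>
     f 1 = 0 \<and> (f \<longlongrightarrow> f 0) (at_right 0)"

definition strictly_convex :: "(real \<Rightarrow> ereal) \<Rightarrow> bool" where
  "strictly_convex f \<longleftrightarrow>
     (\<forall>x\<ge>0. \<forall>y\<ge>0. \<forall>t\<in>{0<..<1}. x \<noteq> y \<longrightarrow>
        f ((1 - t) * x + t * y) < ereal (1 - t) * f x + ereal t * f y)"

text \<open>
  For strictly positive densities only the finite values of the generator on \<open>(0, \<infinity>)\<close>
  enter the integral, so \<open>real_of_ereal\<close> loses nothing. As a convex function has an affine
  minorant, the negative part of the integrand is always integrable; hence the divergence is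
  finite iff the integrand is integrable.
\<close>

definition f_div_integrand ::
    "(real \<Rightarrow> ereal) \<Rightarrow> (real^'n \<Rightarrow> real) \<Rightarrow> (real^'n \<Rightarrow> real) \<Rightarrow> real^'n \<Rightarrow> real" where
  "f_div_integrand f p q z = real_of_ereal (f (p z / q z)) * q z"

definition f_divergence ::
    "(real \<Rightarrow> ereal) \<Rightarrow> (real^'n \<Rightarrow> real) \<Rightarrow> (real^'n \<Rightarrow> real) \<Rightarrow> real" where
  "f_divergence f p q = (LINT z|lborel. f_div_integrand f p q z)"

definition finite_f_divergence ::
    "(real \<Rightarrow> ereal) \<Rightarrow> (real^'n \<Rightarrow> real) \<Rightarrow> (real^'n \<Rightarrow> real) \<Rightarrow> bool" where
  "finite_f_divergence f p q \<longleftrightarrow> integrable lborel (f_div_integrand f p q)"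

definition elliptically_symmetric ::
    "(real^'n \<Rightarrow> real) \<Rightarrow> real^'n \<Rightarrow> real^'n^'n \<Rightarrow> bool" where
  "elliptically_symmetric p \<mu> M \<longleftrightarrow>
     pos_def M \<and> trace M = real CARD('n) \<and>
     (\<forall>z z'. (z - \<mu>) \<bullet> (matrix_inv M *v (z - \<mu>)) = (z' - \<mu>) \<bullet> (matrix_inv M *v (z' - \<mu>))
        \<longrightarrow> p z = p z')"

text \<open>
  Radial functions live on \<open>[0, \<infinity>)\<close>: every condition below is restricted to nonnegative
  arguments.
\<close>

definition radial_function ::
    "(real^'n \<Rightarrow> real) \<Rightarrow> real^'n \<Rightarrow> real^'n^'n \<Rightarrow> (real \<Rightarrow> real) \<Rightarrow> bool" where
  "radial_function p \<mu> A g \<longleftrightarrow>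
     (\<forall>r\<ge>0. 0 \<le> g r) \<and>
     (\<forall>C. transpose C ** C = matrix_inv A \<longrightarrow>
        (\<forall>z. p z = g (norm (C *v (z - \<mu>))) * \<bar>det C\<bar>))"

definition strictly_unimodal :: "(real \<Rightarrow> real) \<Rightarrow> bool" where
  "strictly_unimodal g \<longleftrightarrow> strict_antimono_on {0..} g"

definition strictly_decreasing_tail :: "nat \<Rightarrow> (real \<Rightarrow> real) \<Rightarrow> bool" where
  "strictly_decreasing_tail d g \<longleftrightarrow> (\<exists>R>0. strict_antimono_on {R<..} (\<lambda>r. g r * r ^ d))"

definition elliptical_location_scale_family ::
    "(real^'n \<Rightarrow> real^'n^'n \<Rightarrow> real^'n \<Rightarrow> real) \<Rightarrow> (real \<Rightarrow> real) \<Rightarrow> bool" where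
  "elliptical_location_scale_family q g \<longleftrightarrow>
     (\<forall>\<nu> S. pos_def S \<longrightarrow> prob_density (q \<nu> S) \<and> radial_function (q \<nu> S) \<nu> S g)"

text \<open>
  The integrand of the divergence after the substitution \<open>z = \<nu> + B \<zeta>\<close>, where \<open>S = B B\<^sup>T\<close>.
\<close>

definition reparam_integrand ::
    "(real \<Rightarrow> ereal) \<Rightarrow> (real^'n \<Rightarrow> real) \<Rightarrow> (real \<Rightarrow> real)
      \<Rightarrow> (real^'n) \<times> (real^'n^'n) \<Rightarrow> real^'n \<Rightarrow> real" where
  "reparam_integrand f p g = (\<lambda>(\<nu>, B) \<zeta>.
     real_of_ereal (f (p (\<nu> + B *v \<zeta>) * \<bar>det B\<bar> / g (norm \<zeta>))) * g (norm \<zeta>))"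

text \<open>
  \<open>Basis\<close> consists of the coordinate directions of \<open>(\<nu>, B)\<close>, so the derivatives below are
  the partial derivatives with respect to the entries of \<open>\<nu>\<close> and \<open>B\<close>.
\<close>

definition locally_dominated_partials ::
    "((real^'n) \<times> (real^'n^'n) \<Rightarrow> real^'n \<Rightarrow> real) \<Rightarrow> bool" where
  "locally_dominated_partials F \<longleftrightarrow>
     (\<forall>\<nu>0 B0. invertible B0 \<longrightarrow>
        (\<exists>U G. open U \<and> (\<nu>0, B0) \<in> U \<and> integrable lborel G \<and>
           (AE \<zeta> in lborel. \<forall>x\<in>U. \<forall>b\<in>Basis. \<bar>deriv (\<lambda>t. F (x + t *\<^sub>R b) \<zeta>) 0\<bar> \<le> G \<zeta>)))"

text \<open>
  The positive-definite matrices form an open subset of the space of symmetric matrices, so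
  differentiating within that set tests exactly the symmetric directions.
\<close>

definition stationary_point ::
    "(real^'n \<Rightarrow> real^'n^'n \<Rightarrow> real) \<Rightarrow> real^'n \<Rightarrow> real^'n^'n \<Rightarrow> bool" where
  "stationary_point D \<nu> S \<longleftrightarrow>
     pos_def S \<and>
     ((\<lambda>\<nu>'. D \<nu>' S) has_derivative (\<lambda>_. 0)) (at \<nu>) \<and>
     ((\<lambda>S'. D \<nu> S') has_derivative (\<lambda>_. 0)) (at S within {S'. pos_def S'})"

end

theory Submission
  imports Defs
begin

text \<open>
  Write \<open>V\<close> for the affine vector field by which a variation of \<open>(\<nu>, B)\<close> with
  \<open>B B\<^sup>T = S\<close> moves the points \<open>z = \<nu> + B \<zeta>\<close>. If the variation leaves \<open>det B\<close>
  stationary, stationarity of the divergence says that the integral of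
  \<open>f' (p z / q z) (\<nabla>p z \<bullet> V z)\<close> vanishes.

  Let \<open>\<sigma>\<close> be an affine involution that preserves \<open>p\<close>: the point reflection at \<open>\<mu>\<close> for
  the location, a reflection orthogonal with respect to \<open>M\<^sup>-\<^sup>1\<close> for the scale once
  \<open>\<nu> = \<mu>\<close> is known. As \<open>\<nabla>p z\<close> is a nonpositive multiple of \<open>M\<^sup>-\<^sup>1 (z - \<mu>)\<close>, the field
  \<open>V\<close> can be chosen such that \<open>\<nabla>p z \<bullet> V z\<close> is a nonpositive multiple of \<open>a z - a (\<sigma> z)\<close>,
  where \<open>a z = (z - \<nu>) \<bullet> S\<^sup>-\<^sup>1 (z - \<nu>)\<close>. Since \<open>f'\<close> is strictly increasing and \<open>q\<close>
  is a strictly decreasing function of \<open>a\<close>, the values of the integrand at \<open>z\<close> and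
  \<open>\<sigma> z\<close> have a nonpositive sum. So this sum vanishes almost everywhere, which forces
  \<open>a = a \<circ> \<sigma>\<close>: otherwise \<open>\<nabla>p\<close> would vanish almost everywhere on an open set.
  The point reflection yields \<open>\<nu> = \<mu>\<close>, the other reflections that \<open>S\<close> is a multiple
  of \<open>M\<close>.
\<close>

subsection \<open>Factorization of positive definite matrices\<close>

text \<open>Gram-Schmidt for the inner product \<open>x \<bullet> (S *v y)\<close>: while an index
  is left, the vectors \<open>S *v b j\<close> span a proper subspace, and a nonzero vector
  orthogonal to it, suitably scaled, extends the family.\<close>

lemma pos_def_orthonormal_family:
  fixes S :: "real^'n^'n"
  assumes S: "pos_def S" and "finite I"
  shows "\<exists>b :: 'n \<Rightarrow> real^'n. \<forall>i\<in>I. \<forall>j\<in>I. b i \<bullet> (S *v b j) = (if i = j then 1 else 0)"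
  using \<open>finite I\<close>
proof (induction I rule: finite_induct)
  case empty
  then show ?case by simp
next
  case (insert k I)
  then obtain b :: "'n \<Rightarrow> real^'n"
    where b: "\<And>i j. i \<in> I \<Longrightarrow> j \<in> I \<Longrightarrow> b i \<bullet> (S *v b j) = (if i = j then 1 else 0)"
    by blast
  let ?W = "(\<lambda>j. S *v b j) ` I"
  have "dim ?W \<le> card ?W"
    using insert.hyps by (intro dim_le_card) (auto intro: span_base)
  also have "\<dots> \<le> card I"
    using insert.hyps by (simp add: card_image_le)
  also have "\<dots> < CARD('n)"
    using insert.hyps by (intro psubset_card_mono) auto
  finally have "dim ?W < DIM(real^'n)" by simp
  then obtain x where x: "x \<noteq> 0" "span ?W \<subseteq> {y. x \<bullet> y = 0}"
    using lowdim_subset_hyperplane by blast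
  then have x_left: "x \<bullet> (S *v b j) = 0" if "j \<in> I" for j
    using that by (auto intro: span_base)
  have sym: "u \<bullet> (S *v v) = v \<bullet> (S *v u)" for u v
    using S by (metis dot_lmul_matrix inner_commute pos_def_def transpose_matrix_vector)
  define c where "c = sqrt (x \<bullet> (S *v x))"
  have xx: "x \<bullet> (S *v x) > 0"
    using S x by (auto simp: pos_def_def)
  then have "c > 0" "c * c = x \<bullet> (S *v x)"
    by (auto simp: c_def)
  define b' where "b' = b(k := (1 / c) *\<^sub>R x)"
  have "b' i \<bullet> (S *v b' j) = (if i = j then 1 else 0)"
    if "i \<in> insert k I" "j \<in> insert k I" for i j
    using that insert.hyps b x_left sym[of "b _" x] \<open>c * c = _\<close> \<open>c > 0\<close>
    by (auto simp: b'_def matrix_vector_mult_scaleR field_simps)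
  then show ?case by blast
qed

text \<open>If the rows of \<open>T\<close> are orthonormal with respect to \<open>S\<close>, then
  \<open>T ** S ** transpose T = mat 1\<close>. So \<open>S ** transpose T\<close> is the inverse of
  \<open>T\<close>, and it is the factor sought.\<close>

lemma pos_def_factorization:
  fixes S :: "real^'n^'n"
  assumes S: "pos_def S"
  obtains B :: "real^'n^'n" where "invertible B" "S = B ** transpose B"
proof -
  obtain b :: "'n \<Rightarrow> real^'n"
    where b: "\<And>i j. b i \<bullet> (S *v b j) = (if i = j then 1 else 0)"
    using pos_def_orthonormal_family[OF S, of UNIV] by auto
  define T :: "real^'n^'n" where "T = (\<chi> i. b i)"
  have row: "(T *v x) $ i = b i \<bullet> x" for x i
    by (simp add: T_def matrix_vector_mult_def inner_vec_def)
  have col: "transpose T *v axis j 1 = b j" for j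
    by (simp add: T_def matrix_vector_mult_basis column_def transpose_def)
  have "((T ** S ** transpose T) *v axis j 1) $ i = ((mat 1 :: real^'n^'n) *v axis j 1) $ i" for i j
    unfolding matrix_vector_mul_assoc[symmetric] col row using b[of i j]
    by (simp add: axis_def)
  then have TST: "T ** S ** transpose T = mat 1"
    by (metis (no_types, lifting) matrix_vector_mult_basis column_def vec_eq_iff vec_lambda_beta)
  then have inv: "T ** (S ** transpose T) = mat 1"
    by (simp add: matrix_mul_assoc)
  define B where "B = S ** transpose T"
  have BT: "B ** T = mat 1" "T ** B = mat 1"
    using inv matrix_left_right_inverse unfolding B_def by blast+
  then have "invertible B"
    unfolding invertible_def by blast
  have "transpose (B ** T) = mat 1"
    by (simp add: BT transpose_mat)
  then have "transpose T ** transpose B = mat 1"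
    by (simp add: matrix_transpose_mul)
  then have "B ** transpose B = S"
    by (metis B_def matrix_mul_assoc matrix_mul_rid)
  with \<open>invertible B\<close> that show thesis by blast
qed

lemma inner_mult_transpose:
  fixes B :: "real^'n^'m"
  shows "x \<bullet> ((B ** transpose B) *v y) = (transpose B *v x) \<bullet> (transpose B *v y)"
  by (metis dot_lmul_matrix matrix_vector_mul_assoc transpose_matrix_vector)

lemma invertible_mult_eq_0_iff:
  fixes B :: "real^'n^'n"
  assumes "invertible B"
  shows "B *v x = 0 \<longleftrightarrow> x = 0"
  using inj_matrix_vector_mult[OF assms] by (metis injD matrix_vector_mult_0_right)

lemma pos_def_mult_transpose:
  fixes B :: "real^'n^'n"
  assumes "invertible B"
  shows "pos_def (B ** transpose B)"
proof -
  have "invertible (transpose B)"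
    using assms by (rule transpose_invertible)
  then show ?thesis
    unfolding pos_def_def inner_mult_transpose
    by (simp add: matrix_transpose_mul invertible_mult_eq_0_iff del: transpose_matrix_vector)
qed

lemma matrix_inv_transpose_mult:
  fixes B C :: "real^'n^'n"
  assumes "C ** B = mat 1"
  shows "matrix_inv (B ** transpose B) = transpose C ** C"
proof -
  have "B ** C = mat 1"
    using assms matrix_left_right_inverse by blast
  moreover have "transpose B ** transpose C = mat 1"
    by (metis assms matrix_transpose_mul transpose_mat calculation)
  ultimately have "(B ** transpose B) ** (transpose C ** C) = mat 1"
    by (metis matrix_mul_assoc matrix_mul_rid)
  moreover from this have "(transpose C ** C) ** (B ** transpose B) = mat 1"
    using matrix_left_right_inverse by blast
  \<comment> \<open>\<open>matrix_inv\<close> is defined by choice, so its property becomes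
    available once one inverse is exhibited.\<close>
  ultimately have "(B ** transpose B) ** matrix_inv (B ** transpose B) = mat 1"
    unfolding matrix_inv_def by (rule conjunct1 [OF someI_ex, OF exI, OF conjI])
  then show ?thesis
    using \<open>(transpose C ** C) ** _ = _\<close> by (metis matrix_mul_assoc matrix_mul_lid matrix_mul_rid)
qed

subsection \<open>Linear substitution in Lebesgue integrals\<close>

lemma nn_integral_lborel_shift:
  fixes f :: "'a::euclidean_space \<Rightarrow> ennreal"
  assumes [measurable]: "f \<in> borel_measurable borel"
  shows "(\<integral>\<^sup>+x. f (c + x) \<partial>lborel) = (\<integral>\<^sup>+x. f x \<partial>lborel)"
  by (subst (2) lborel_distr_plus[of c, symmetric]) (simp add: nn_integral_distr)

lemma nn_integral_lborel_reflect:
  fixes f :: "'a::euclidean_space \<Rightarrow> ennreal"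
  assumes [measurable]: "f \<in> borel_measurable borel"
  shows "(\<integral>\<^sup>+x. f (c - x) \<partial>lborel) = (\<integral>\<^sup>+x. f x \<partial>lborel)"
  by (subst (2) lborel_affine[of "-1" c]) (simp_all add: nn_integral_density nn_integral_distr)

lemma measurable_matrix_vector_mult [measurable]:
  fixes A :: "real^'n^'m"
  shows "(*v) A \<in> borel \<rightarrow>\<^sub>M borel"
  by (intro borel_measurable_continuous_onI continuous_intros)

text \<open>
  The uniqueness argument for Haar measure, with Fubini's theorem for
  \<open>f x * g (T *v y)\<close>. The substitution rule of the library with \<open>\<bar>det T\<bar>\<close> needs a
  well-ordered index type; here the factor comes from a function \<open>\<phi>\<close> whose integrals
  are known, namely the radial profile of the location-scale family.
\<close>

lemma nn_integral_lborel_linear: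
  fixes f g :: "real^'n \<Rightarrow> ennreal" and T :: "real^'n^'n"
  assumes [measurable]: "f \<in> borel_measurable borel" "g \<in> borel_measurable borel"
    and T: "invertible T"
  shows "(\<integral>\<^sup>+x. f x \<partial>lborel) * (\<integral>\<^sup>+x. g (T *v x) \<partial>lborel)
       = (\<integral>\<^sup>+x. f (T *v x) \<partial>lborel) * (\<integral>\<^sup>+x. g x \<partial>lborel)"
proof -
  obtain T' where T': "T ** T' = mat 1"
    using T unfolding invertible_def by blast
  then have TT': "T *v (T' *v x) = x" for x
    by (simp add: matrix_vector_mul_assoc)
  have "(\<integral>\<^sup>+x. f x \<partial>lborel) * (\<integral>\<^sup>+y. g (T *v y) \<partial>lborel)
      = (\<integral>\<^sup>+y. (\<integral>\<^sup>+x. g (T *v y) * f x \<partial>lborel) \<partial>lborel)"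
    by (simp add: nn_integral_cmult nn_integral_multc mult.commute)
  \<comment> \<open>Shift \<open>x\<close> by \<open>T *v y\<close>.\<close>
  also have "\<dots> = (\<integral>\<^sup>+y. (\<integral>\<^sup>+x. g (T *v y) * f (T *v y + x) \<partial>lborel) \<partial>lborel)"
    by (simp add: nn_integral_cmult nn_integral_lborel_shift)
  also have "\<dots> = (\<integral>\<^sup>+x. (\<integral>\<^sup>+y. g (T *v y) * f (T *v y + x) \<partial>lborel) \<partial>lborel)"
    by (rule lborel_pair.Fubini') simp
  \<comment> \<open>Shift \<open>y\<close> by \<open>- (T' *v x)\<close>. This moves
    \<open>x\<close> from the argument of \<open>f\<close> into that of \<open>g\<close>, where
    translation and reflection invariance remove it.\<close>
  also have "\<dots> = (\<integral>\<^sup>+x. (\<integral>\<^sup>+y. g (T *v (- (T' *v x) + y)) * f (T *v (- (T' *v x) + y) + x) \<partial>lborel) \<partial>lborel)"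
    by (subst nn_integral_lborel_shift) simp_all
  also have "\<dots> = (\<integral>\<^sup>+x. (\<integral>\<^sup>+y. g (T *v y - x) * f (T *v y) \<partial>lborel) \<partial>lborel)"
    by (simp add: matrix_vector_right_distrib TT' matrix_vector_mult_diff_distrib)
  also have "\<dots> = (\<integral>\<^sup>+y. (\<integral>\<^sup>+x. g (T *v y - x) * f (T *v y) \<partial>lborel) \<partial>lborel)"
    by (rule lborel_pair.Fubini') simp
  also have "\<dots> = (\<integral>\<^sup>+y. f (T *v y) * (\<integral>\<^sup>+x. g x \<partial>lborel) \<partial>lborel)"
    by (subst nn_integral_multc) (simp_all add: nn_integral_lborel_reflect mult.commute)
  also have "\<dots> = (\<integral>\<^sup>+x. f (T *v x) \<partial>lborel) * (\<integral>\<^sup>+x. g x \<partial>lborel)"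
    by (simp add: nn_integral_multc)
  finally show ?thesis .
qed

text \<open>By \<open>nn_integral_lborel_linear\<close>, the substitution \<open>T\<close> changes
  all integrals by a common factor, and \<open>\<phi>\<close> shows that this factor is
  \<open>1 / d\<close>. It is applied to the indicator of \<open>A\<close> translated by
  \<open>- c\<close>.\<close>

lemma lborel_affine_matrix:
  fixes \<phi> :: "real^'n \<Rightarrow> ennreal" and T :: "real^'n^'n"
  assumes [measurable]: "\<phi> \<in> borel_measurable borel" and T: "invertible T"
    and \<phi>: "(\<integral>\<^sup>+x. \<phi> x \<partial>lborel) = 1" "ennreal d * (\<integral>\<^sup>+x. \<phi> (T *v x) \<partial>lborel) = 1"
  shows "lborel = density (distr lborel borel (\<lambda>x. c + T *v x)) (\<lambda>_. ennreal d)"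
proof (rule measure_eqI)
  fix A :: "(real^'n) set"
  assume "A \<in> sets lborel"
  then have [measurable]: "A \<in> sets borel" by simp
  define f :: "real^'n \<Rightarrow> ennreal" where "f x = indicator A (c + x)" for x
  have [measurable]: "f \<in> borel_measurable borel"
    unfolding f_def by measurable
  have "emeasure lborel A = (\<integral>\<^sup>+x. f x \<partial>lborel)"
    by (simp add: f_def nn_integral_lborel_shift)
  also have "\<dots> = ennreal d * ((\<integral>\<^sup>+x. f x \<partial>lborel) * (\<integral>\<^sup>+x. \<phi> (T *v x) \<partial>lborel))"
    using \<phi>(2) by (metis mult.left_commute mult.right_neutral)
  also have "\<dots> = ennreal d * (\<integral>\<^sup>+x. f (T *v x) \<partial>lborel)"
    by (simp add: nn_integral_lborel_linear[OF _ _ T] \<phi>)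
  also have "\<dots> = (\<integral>\<^sup>+x. ennreal d * indicator A (c + T *v x) \<partial>lborel)"
    by (simp add: f_def nn_integral_cmult)
  also have "\<dots> = (\<integral>\<^sup>+x. ennreal d * indicator A x \<partial>distr lborel borel (\<lambda>x. c + T *v x))"
    by (simp add: nn_integral_distr)
  also have "\<dots> = emeasure (density (distr lborel borel (\<lambda>x. c + T *v x)) (\<lambda>_. ennreal d)) A"
    by (simp add: emeasure_density)
  finally show "emeasure lborel A = emeasure (density (distr lborel borel (\<lambda>x. c + T *v x)) (\<lambda>_. ennreal d)) A" .
qed simp

text \<open>The instances of \<open>int\<close> at \<open>mat 1\<close> and at \<open>T\<close> are
  the two normalizations that \<open>lborel_affine_matrix\<close> asks for, with
  \<open>d = \<bar>det T\<bar>\<close>.\<close>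

lemma has_bochner_integral_lborel_affine:
  fixes f \<phi> :: "real^'n \<Rightarrow> real" and T :: "real^'n^'n"
  assumes nonneg: "\<And>x. 0 \<le> \<phi> x"
    and int: "\<And>T. invertible T \<Longrightarrow> has_bochner_integral lborel (\<lambda>x. \<phi> (T *v x) * \<bar>det T\<bar>) 1"
    and T: "invertible T" and f: "has_bochner_integral lborel f I"
  shows "has_bochner_integral lborel (\<lambda>x. f (c + T *v x) * \<bar>det T\<bar>) I"
proof -
  define d where "d = \<bar>det T\<bar>"
  have d: "0 \<le> d" by (simp add: d_def)
  have "invertible (mat 1 :: real^'n^'n)"
    unfolding invertible_def by (auto intro!: exI[of _ "mat 1"])
  from int[OF this] int[OF T]
  have \<phi>: "has_bochner_integral lborel \<phi> 1" "has_bochner_integral lborel (\<lambda>x. \<phi> (T *v x) * d) 1"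
    by (simp_all add: d_def)
  have [measurable]: "\<phi> \<in> borel_measurable borel" "f \<in> borel_measurable borel"
    using \<phi>(1) f by (auto dest: borel_measurable_has_bochner_integral)
  have 1: "(\<integral>\<^sup>+x. ennreal (\<phi> x) \<partial>lborel) = 1"
    using nonneg \<phi> by (simp add: nn_integral_eq_integral has_bochner_integral_iff)
  have "ennreal d * (\<integral>\<^sup>+x. ennreal (\<phi> (T *v x)) \<partial>lborel) = (\<integral>\<^sup>+x. ennreal (\<phi> (T *v x) * d) \<partial>lborel)"
    using nonneg d by (simp add: nn_integral_cmult[symmetric] ennreal_mult mult.commute)
  also have "\<dots> = 1"
    using nonneg \<phi> d by (simp add: nn_integral_eq_integral has_bochner_integral_iff)
  finally have 2: "lborel = density (distr lborel borel (\<lambda>x. c + T *v x)) (\<lambda>_. ennreal d)"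
    by (intro lborel_affine_matrix[OF _ T 1]) simp_all
  have "integrable (density (distr lborel borel (\<lambda>x. c + T *v x)) (\<lambda>_. ennreal d)) f"
    using f unfolding 2[symmetric] by (simp add: has_bochner_integral_iff)
  then have "integrable lborel (\<lambda>x. f (c + T *v x) * d)"
    using d by (simp add: integrable_density integrable_distr_eq mult.commute)
  moreover have "(LINT x|lborel. f (c + T *v x) * d) = I"
  proof -
    have "I = (LINT x|density (distr lborel borel (\<lambda>x. c + T *v x)) (\<lambda>_. ennreal d). f x)"
      using f unfolding 2[symmetric] by (simp add: has_bochner_integral_iff)
    then show ?thesis
      using d by (simp add: integral_density integral_distr mult.commute)
  qed
  ultimately show ?thesis by (simp add: has_bochner_integral_iff d_def)
qed

subsection \<open>Convexity and elliptical gradients\<close>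

lemma strictly_convex_deriv_strict_mono:
  fixes f :: "real \<Rightarrow> ereal"
  assumes f: "f_generator f" "strictly_convex f"
    and diff: "(\<lambda>u. real_of_ereal (f u)) differentiable_on {0<..}"
    and xy: "0 < x" "x < y"
  shows "deriv (\<lambda>u. real_of_ereal (f u)) x < deriv (\<lambda>u. real_of_ereal (f u)) y"
proof -
  define h where "h u = real_of_ereal (f u)" for u
  have fin: "f u = ereal (h u)" if "0 < u" for u
    using f(1) that by (simp add: f_generator_def h_def ereal_real)
  have convex_comb: "h ((1 - t) * u + t * v) < (1 - t) * h u + t * h v"
    if "0 < u" "0 < v" "u \<noteq> v" "t \<in> {0<..<1}" for u v t
  proof -
    have "0 < (1 - t) * u + t * v"
      using that by (simp add: add_pos_pos)
    moreover have "f ((1 - t) * u + t * v) < ereal (1 - t) * f u + ereal t * f v"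
      using f(2) that by (simp add: strictly_convex_def)
    ultimately show ?thesis
      using that by (simp add: fin)
  qed
  have convex: "convex_on {0<..} h"
  proof (rule convex_onI)
    fix t u v :: real
    assume "0 < t" "t < 1" "u \<in> {0<..}" "v \<in> {0<..}"
    then show "h ((1 - t) *\<^sub>R u + t *\<^sub>R v) \<le> (1 - t) * h u + t * h v"
      using convex_comb[of u v t] by (cases "u = v") (auto simp: algebra_simps less_imp_le)
  qed (simp add: convex_real_interval)
  have D: "(h has_real_derivative deriv h u) (at u)" if "0 < u" for u
    using diff that unfolding h_def[symmetric]
    by (simp add: DERIV_deriv_iff_real_differentiable differentiable_on_eq_differentiable_at open_greaterThan)
  have tangent: "deriv h u * (v - u) \<le> h v - h u" if "0 < u" "0 < v" for u v
  proof (rule convex_on_imp_above_tangent[OF convex])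
    show "(h has_real_derivative deriv h u) (at u within {0<..})"
      using D[OF that(1)] by (rule has_field_derivative_at_within)
  qed (use that in \<open>simp_all add: interior_open connected_Ioi\<close>)
  \<comment> \<open>The tangent at \<open>u\<close> bounds \<open>h\<close> from below at the
    midpoint of \<open>u\<close> and \<open>v\<close>, and strict convexity puts that value strictly
    below the mean of \<open>h u\<close> and \<open>h v\<close>.\<close>
  have strict: "deriv h u * (v - u) < h v - h u" if "0 < u" "0 < v" "u \<noteq> v" for u v
    using tangent[of u "(u + v) / 2"] convex_comb[of u v "1/2"] that
    by (simp add: field_simps)
  from strict[of x y] strict[of y x] xy
  have "(deriv h y - deriv h x) * (y - x) > 0"
    by (simp add: algebra_simps)
  then show ?thesis
    using xy unfolding h_def[symmetric] by (simp add: zero_less_mult_iff)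
qed

lemma even_has_real_derivative_0:
  fixes \<phi> :: "real \<Rightarrow> real"
  assumes D: "(\<phi> has_real_derivative D) (at 0)" and even: "\<And>s. \<phi> (- s) = \<phi> s"
  shows "D = 0"
proof -
  have "((\<lambda>s. \<phi> (- s)) has_real_derivative D * - 1) (at 0)"
    by (rule DERIV_chain2[where f = \<phi>]) (auto intro!: derivative_eq_intros D)
  moreover have "(\<lambda>s. \<phi> (- s)) = \<phi>"
    by (rule ext) (rule even)
  ultimately have "(\<phi> has_real_derivative - D) (at 0)" by simp
  from DERIV_unique[OF D this] show ?thesis by simp
qed

lemma has_real_derivative_along_line:
  fixes p :: "'a::real_normed_vector \<Rightarrow> real"
  assumes "(p has_derivative p') (at z)"
  shows "((\<lambda>s. p (z + s *\<^sub>R v)) has_real_derivative p' v) (at 0)"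
proof -
  have "((\<lambda>s. p (z + s *\<^sub>R v)) has_derivative (\<lambda>s. p' (s *\<^sub>R v))) (at 0)"
    by (rule has_derivative_compose[where g = p]) (auto intro!: derivative_eq_intros assms)
  moreover have "p' (s *\<^sub>R v) = p' v * s" for s
    using assms by (simp add: has_derivative_def bounded_linear.linear linear_scale)
  ultimately show ?thesis
    by (simp add: has_field_derivative_def mult_commute_abs)
qed

text \<open>
  Along directions orthogonal to \<open>z - \<mu>\<close> the function is even, so its derivative vanishes
  there and the gradient is radial.
\<close>

lemma elliptical_gradient:
  fixes p :: "real^'n \<Rightarrow> real" and C :: "real^'n^'n"
  assumes p': "(p has_derivative p') (at z)"
    and anti: "\<And>x y. norm (C *v (x - \<mu>)) \<le> norm (C *v (y - \<mu>)) \<Longrightarrow> p y \<le> p x"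
    and C: "\<And>x. C *v x = 0 \<Longrightarrow> x = 0"
  obtains k where "k \<le> 0" "\<And>v. p' v = k * ((C *v (z - \<mu>)) \<bullet> (C *v v))"
proof -
  define w where "w = z - \<mu>"
  have lin: "linear p'"
    using p' by (simp add: has_derivative_def bounded_linear.linear)
  have orth: "p' v = 0" if "(C *v w) \<bullet> (C *v v) = 0" for v
  proof (rule even_has_real_derivative_0[OF has_real_derivative_along_line[OF p']])
    fix s :: real
    have "norm (C *v (z + (- s) *\<^sub>R v - \<mu>)) = norm (C *v (z + s *\<^sub>R v - \<mu>))"
    proof -
      have "C *v (z + t *\<^sub>R v - \<mu>) = C *v w + t *\<^sub>R (C *v v)" for t
        by (simp add: w_def matrix_vector_mult_diff_distrib matrix_vector_right_distrib matrix_vector_mult_scaleR)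
      note eq = this
      show ?thesis
        unfolding eq using that by (simp add: norm_eq inner_add inner_diff inner_commute)
    qed
    then show "p (z + (- s) *\<^sub>R v) = p (z + s *\<^sub>R v)"
      by (intro antisym anti) auto
  qed
  \<comment> \<open>Moving from \<open>z\<close> along \<open>w\<close> leads away from
    \<open>\<mu>\<close>, where \<open>p\<close> cannot be larger.\<close>
  have "p' w \<le> 0"
  proof (rule ccontr)
    assume "\<not> p' w \<le> 0"
    then obtain d where d: "d > 0" "\<And>h. 0 < h \<Longrightarrow> h < d \<Longrightarrow> p z < p (z + h *\<^sub>R w)"
      using DERIV_pos_inc_right[OF has_real_derivative_along_line[OF p', of w]] by auto
    have "norm (C *v (z - \<mu>)) \<le> norm (C *v (z + (d/2) *\<^sub>R w - \<mu>))"
    proof -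
      have "z + (d/2) *\<^sub>R w - \<mu> = (1 + d/2) *\<^sub>R (z - \<mu>)"
        by (simp add: w_def algebra_simps)
      then show ?thesis
        using d(1) by (simp add: matrix_vector_mult_scaleR mult_le_cancel_right1)
    qed
    then show False
      using anti d(2)[of "d/2"] d(1) by fastforce
  qed
  \<comment> \<open>For \<open>w = 0\<close> the quotient is 0 by convention, and every direction is
    covered by \<open>orth\<close>. Otherwise \<open>c\<close> below is the projection coefficient
    that makes \<open>v - c *\<^sub>R w\<close> orthogonal to \<open>w\<close> under
    \<open>C\<close>.\<close>
  define k where "k = p' w / ((C *v w) \<bullet> (C *v w))"
  have "p' v = k * ((C *v w) \<bullet> (C *v v))" for v
  proof (cases "w = 0")
    case True
    then show ?thesis using orth[of v] by simp
  next
    case False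
    then have Cw: "(C *v w) \<bullet> (C *v w) \<noteq> 0"
      using C by auto
    define c where "c = ((C *v w) \<bullet> (C *v v)) / ((C *v w) \<bullet> (C *v w))"
    have "p' (v - c *\<^sub>R w) = 0"
      using Cw by (intro orth) (simp add: c_def matrix_vector_mult_diff_distrib matrix_vector_mult_scaleR inner_diff)
    then show ?thesis
      using lin by (simp add: linear_diff linear_scale c_def k_def)
  qed
  moreover have "k \<le> 0"
    using \<open>p' w \<le> 0\<close> by (simp add: k_def divide_nonpos_nonneg)
  ultimately show thesis
    using that w_def by blast
qed

subsection \<open>Differentiation under the integral\<close>

text \<open>Dominated convergence for the difference quotients \<open>Q h\<close>. The bound on the
  partial derivatives yields \<open>c * G \<zeta>\<close> in direction \<open>v\<close>, with
  \<open>c\<close> the l1-norm of \<open>v\<close>, and the mean value inequality passes this on to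
  the quotients.\<close>

lemma has_derivative_leibniz_directional:
  fixes F :: "'a::euclidean_space \<Rightarrow> 'b \<Rightarrow> real"
  assumes U: "open U" "x0 \<in> U"
    and G: "integrable M G"
    and bound: "AE \<zeta> in M. \<forall>x\<in>U. \<forall>b\<in>Basis. \<bar>deriv (\<lambda>t. F (x + t *\<^sub>R b) \<zeta>) 0\<bar> \<le> G \<zeta>"
    and F: "\<And>x. x \<in> U \<Longrightarrow> integrable M (F x)"
    and diff: "\<And>x \<zeta>. x \<in> U \<Longrightarrow> (\<lambda>x. F x \<zeta>) differentiable (at x)"
    and D: "\<And>\<zeta>. ((\<lambda>s. F (x0 + s *\<^sub>R v) \<zeta>) has_real_derivative D \<zeta>) (at 0)"
  shows "integrable M D"
    and "((\<lambda>s. LINT \<zeta>|M. F (x0 + s *\<^sub>R v) \<zeta>) has_real_derivative (LINT \<zeta>|M. D \<zeta>)) (at 0)"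
proof -
  have "((\<lambda>s. x0 + s *\<^sub>R v) \<longlongrightarrow> x0 + 0 *\<^sub>R v) (at 0)"
    by (intro tendsto_intros)
  then have "eventually (\<lambda>s. x0 + s *\<^sub>R v \<in> U) (at 0)"
    using U by (intro topological_tendstoD) auto
  then obtain e where e: "e > 0" "\<And>s. s \<noteq> 0 \<Longrightarrow> \<bar>s\<bar> < e \<Longrightarrow> x0 + s *\<^sub>R v \<in> U"
    by (auto simp: eventually_at dist_real_def)
  then have inU: "x0 + s *\<^sub>R v \<in> U" if "\<bar>s\<bar> < e" for s
    using that U by (cases "s = 0") auto
  define c where "c = (\<Sum>b\<in>Basis. \<bar>v \<bullet> b\<bar>)"
  define Q where "Q h \<zeta> = (F (x0 + h *\<^sub>R v) \<zeta> - F x0 \<zeta>) / h" for h \<zeta>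
  have Q_bound: "AE \<zeta> in M. \<forall>h. h \<noteq> 0 \<and> \<bar>h\<bar> < e \<longrightarrow> norm (Q h \<zeta>) \<le> c * G \<zeta>"
    using bound
  proof eventually_elim
    case (elim \<zeta>)
    define F' where "F' x = frechet_derivative (\<lambda>x. F x \<zeta>) (at x)" for x
    have F': "((\<lambda>x. F x \<zeta>) has_derivative F' x) (at x)" if "x \<in> U" for x
      using diff[OF that] by (simp add: F'_def frechet_derivative_works)
    have F'v: "\<bar>F' x v\<bar> \<le> c * G \<zeta>" if x: "x \<in> U" for x
    proof -
      have lin: "linear (F' x)"
        using F'[OF x] by (simp add: has_derivative_def bounded_linear.linear)
      have "F' x v = (\<Sum>b\<in>Basis. (v \<bullet> b) * F' x b)"
        by (subst (1) euclidean_representation[of v, symmetric])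
          (simp add: linear_sum[OF lin] linear_scale[OF lin])
      also have "\<bar>\<dots>\<bar> \<le> (\<Sum>b\<in>Basis. \<bar>v \<bullet> b\<bar> * G \<zeta>)"
      proof (intro order_trans[OF sum_abs] sum_mono)
        fix b :: 'a assume b: "b \<in> Basis"
        have "deriv (\<lambda>t. F (x + t *\<^sub>R b) \<zeta>) 0 = F' x b"
          by (intro DERIV_imp_deriv has_real_derivative_along_line F' x)
        then have "\<bar>F' x b\<bar> \<le> G \<zeta>"
          using elim x b by metis
        then show "\<bar>(v \<bullet> b) * F' x b\<bar> \<le> \<bar>v \<bullet> b\<bar> * G \<zeta>"
          by (simp add: abs_mult mult_left_mono)
      qed
      finally show ?thesis by (simp add: c_def sum_distrib_right)
    qed
    show ?case
    proof (intro allI impI)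
      fix h :: real assume h: "h \<noteq> 0 \<and> \<bar>h\<bar> < e"
      have der: "((\<lambda>s. F (x0 + s *\<^sub>R v) \<zeta>) has_real_derivative F' (x0 + s *\<^sub>R v) v) (at s)"
        if "\<bar>s\<bar> < e" for s
      proof -
        have "((\<lambda>t. F ((x0 + s *\<^sub>R v) + t *\<^sub>R v) \<zeta>) has_real_derivative F' (x0 + s *\<^sub>R v) v) (at 0)"
          using has_real_derivative_along_line[OF F'[OF inU[OF that]]] .
        then have "((\<lambda>t. F (x0 + (t + s) *\<^sub>R v) \<zeta>) has_real_derivative F' (x0 + s *\<^sub>R v) v) (at 0)"
          by (simp add: scaleR_add_left algebra_simps)
        then show ?thesis
          using DERIV_at_within_shift[of "\<lambda>s. F (x0 + s *\<^sub>R v) \<zeta>" "F' (x0 + s *\<^sub>R v) v" s 0 UNIV]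
          by (simp add: add.commute)
      qed
      have "norm (F (x0 + h *\<^sub>R v) \<zeta> - F (x0 + 0 *\<^sub>R v) \<zeta>) \<le> (c * G \<zeta>) * norm (h - 0)"
      proof (rule field_differentiable_bound[where S = "ball 0 e" and f' = "\<lambda>s. F' (x0 + s *\<^sub>R v) v"])
        show "((\<lambda>s. F (x0 + s *\<^sub>R v) \<zeta>) has_real_derivative F' (x0 + s *\<^sub>R v) v) (at s within ball 0 e)"
          if "s \<in> ball 0 e" for s
          using that der[of s] by (auto simp: dist_real_def intro: has_field_derivative_at_within)
        show "norm (F' (x0 + s *\<^sub>R v) v) \<le> c * G \<zeta>" if "s \<in> ball 0 e" for s
          using that inU F'v by (simp add: dist_real_def)
      qed (use e h in \<open>auto simp: dist_real_def\<close>)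
      then show "norm (Q h \<zeta>) \<le> c * G \<zeta>"
        using h by (simp add: Q_def field_simps)
    qed
  qed
  have Q_int: "integrable M (Q h)" if "\<bar>h\<bar> < e" for h
    unfolding Q_def using F[OF inU[OF that]] F[OF U(2)] by (intro integrable_divide Bochner_Integration.integrable_diff)
  have Q_lim: "((\<lambda>h. Q h \<zeta>) \<longlongrightarrow> D \<zeta>) (at 0)" for \<zeta>
    using D[of \<zeta>] by (simp add: has_field_derivative_iff Q_def)
  have main: "integrable M D \<and> (\<lambda>n. LINT \<zeta>|M. Q (X n) \<zeta>) \<longlonglongrightarrow> (LINT \<zeta>|M. D \<zeta>)"
    if X: "\<And>n. X n \<noteq> 0" "\<And>n. \<bar>X n\<bar> < e" "X \<longlonglongrightarrow> 0" for X
  proof -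
    have lim: "(\<lambda>n. Q (X n) \<zeta>) \<longlonglongrightarrow> D \<zeta>" for \<zeta>
      using Q_lim X by (auto simp: tendsto_at_iff_sequentially o_def)
    have meas: "D \<in> borel_measurable M"
      by (rule borel_measurable_LIMSEQ_real[OF lim]) (use Q_int X in auto)
    have bd: "AE \<zeta> in M. norm (Q (X n) \<zeta>) \<le> c * G \<zeta>" for n
      using Q_bound by eventually_elim (use X in auto)
    have lim': "AE \<zeta> in M. (\<lambda>n. Q (X n) \<zeta>) \<longlonglongrightarrow> D \<zeta>"
      by (simp add: lim)
    have Qm: "Q (X n) \<in> borel_measurable M" for n
      using Q_int X by auto
    note dom = meas Qm integrable_mult_right[OF G, of c] lim' bd
    show ?thesis
      using integrable_dominated_convergence[OF dom] integral_dominated_convergence[OF dom] by blast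
  qed
  \<comment> \<open>Integrability of \<open>D\<close> follows from \<open>main\<close> for any one
    admissible sequence.\<close>
  define X0 where "X0 n = e / 2 * inverse (real (Suc n))" for n
  have "X0 n \<noteq> 0" "\<bar>X0 n\<bar> < e" for n
  proof -
    have "inverse (real (Suc n)) \<le> 1" by (simp add: field_simps)
    then have "X0 n \<le> e / 2 * 1"
      unfolding X0_def using e by (intro mult_left_mono) auto
    moreover have "0 < X0 n" using e by (simp add: X0_def)
    ultimately show "X0 n \<noteq> 0" "\<bar>X0 n\<bar> < e" using e by auto
  qed
  moreover have "X0 \<longlonglongrightarrow> 0"
    unfolding X0_def using tendsto_mult_right_zero[OF LIMSEQ_inverse_real_of_nat] .
  ultimately show "integrable M D"
    using main by blast
  have Q_LINT: "((LINT \<zeta>|M. F (x0 + h *\<^sub>R v) \<zeta>) - (LINT \<zeta>|M. F x0 \<zeta>)) / h = (LINT \<zeta>|M. Q h \<zeta>)"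
    if "\<bar>h\<bar> < e" for h
    unfolding Q_def using F[OF inU[OF that]] F[OF U(2)]
    by (simp add: Bochner_Integration.integral_diff)
  show "((\<lambda>s. LINT \<zeta>|M. F (x0 + s *\<^sub>R v) \<zeta>) has_real_derivative (LINT \<zeta>|M. D \<zeta>)) (at 0)"
    unfolding has_field_derivative_iff tendsto_at_iff_sequentially o_def
  proof (intro allI impI)
    fix X :: "nat \<Rightarrow> real"
    assume X: "\<forall>i. X i \<in> UNIV - {0}" "X \<longlonglongrightarrow> 0"
    then have "eventually (\<lambda>n. dist (X n) 0 < e) sequentially"
      using e by (intro tendstoD)
    then obtain N where N: "\<And>n. n \<ge> N \<Longrightarrow> \<bar>X n\<bar> < e"
      by (auto simp: eventually_sequentially)
    \<comment> \<open>Dropping the first \<open>N\<close> terms keeps the whole sequence within the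
      radius \<open>e\<close>.\<close>
    have "(\<lambda>n. LINT \<zeta>|M. Q (X (n + N)) \<zeta>) \<longlonglongrightarrow> (LINT \<zeta>|M. D \<zeta>)"
      using X N main[of "\<lambda>n. X (n + N)"] by (auto intro: LIMSEQ_ignore_initial_segment)
    then have "(\<lambda>n. ((LINT \<zeta>|M. F (x0 + X (n + N) *\<^sub>R v) \<zeta>) - (LINT \<zeta>|M. F x0 \<zeta>)) / X (n + N))
        \<longlonglongrightarrow> (LINT \<zeta>|M. D \<zeta>)"
      using N by (simp add: Q_LINT)
    then show "(\<lambda>n. ((LINT \<zeta>|M. F (x0 + X n *\<^sub>R v) \<zeta>) - (LINT \<zeta>|M. F (x0 + 0 *\<^sub>R v) \<zeta>)) / (X n - 0))
        \<longlonglongrightarrow> (LINT \<zeta>|M. D \<zeta>)"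
      by (simp) (rule LIMSEQ_offset[where k = N])
  qed
qed

subsection \<open>Symmetry of the level sets\<close>

lemma continuous_on_matrix_vector_mult [continuous_intros]:
  fixes A :: "real^'n^'m"
  assumes "continuous_on S f"
  shows "continuous_on S (\<lambda>x. A *v f x)"
  using bounded_linear.continuous_on[OF matrix_vector_mul_bounded_linear assms] .

text \<open>For each fixed \<open>t\<close> the translated null set is null. Fubini's theorem then
  exchanges the order of \<open>z\<close> and \<open>t\<close>.\<close>

lemma AE_lborel_lines:
  fixes Q :: "'a::euclidean_space \<Rightarrow> bool"
  assumes "AE z in lborel. Q z"
  shows "AE z in lborel. AE t in lborel. Q (z + t *\<^sub>R e)"
proof -
  obtain N where N: "N \<in> null_sets lborel" "{z. \<not> Q z} \<subseteq> N"
    using assms by (auto simp: eventually_ae_filter)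
  then have [measurable]: "N \<in> sets borel" by auto
  have "AE z in lborel. z + t *\<^sub>R e \<notin> N" for t
  proof -
    have "{z. z - (- (t *\<^sub>R e)) \<in> N} \<in> null_sets lborel"
      by (rule null_sets_translation[OF N(1)])
    from AE_not_in[OF this] show ?thesis by simp
  qed
  then have "AE t in lborel. AE z in lborel. z + t *\<^sub>R e \<notin> N"
    by simp
  moreover have "{x \<in> space (lborel \<Otimes>\<^sub>M lborel). fst x + snd x *\<^sub>R e \<notin> N}
      \<in> sets (lborel \<Otimes>\<^sub>M lborel)"
    by measurable
  ultimately have "AE z in lborel. AE t in lborel. z + t *\<^sub>R e \<notin> N"
    by (subst lborel_pair.AE_commute) auto
  then show ?thesis
    by eventually_elim (use N(2) in \<open>auto elim: eventually_mono\<close>)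
qed

text \<open>The gauge integral recovers \<open>\<phi>\<close> from any derivative that exists
  everywhere, and null sets do not affect it. Differentiability at every point is what excludes
  functions like Cantor's.\<close>

lemma AE_zero_deriv_imp_eq:
  fixes \<phi> :: "real \<Rightarrow> real"
  assumes D: "\<And>t. (\<phi> has_real_derivative \<phi>' t) (at t)" and ab: "a \<le> b"
    and AE0: "AE t in lborel. t \<in> {a..b} \<longrightarrow> \<phi>' t = 0"
  shows "\<phi> a = \<phi> b"
proof -
  have "(\<phi>' has_integral \<phi> b - \<phi> a) {a..b}"
    using D ab by (intro fundamental_theorem_of_calculus)
      (auto simp: has_real_derivative_iff_has_vector_derivative[symmetric] intro: has_field_derivative_at_within)
  then have "((\<lambda>_. 0) has_integral \<phi> b - \<phi> a) {a..b}"
    using has_integral_AE[OF AE0] by simp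
  then show ?thesis
    using has_integral_unique[OF has_integral_0] by fastforce
qed

text \<open>A line meets a sphere in at most two points, but \<open>x\<close>, \<open>x + y\<close>
  and \<open>x + 2 *\<^sub>R y\<close> would be three.\<close>

lemma norm_eq_midpoint_imp_eq:
  fixes x y :: "'a::real_inner"
  assumes "norm (x + y) = norm x" "norm (x + 2 *\<^sub>R y) = norm x"
  shows "y = 0"
proof -
  have "2 * (x \<bullet> y) + y \<bullet> y = 0" "4 * (x \<bullet> y) + 4 * (y \<bullet> y) = 0"
    using assms by (simp_all add: norm_eq inner_add inner_commute)
  then have "y \<bullet> y = 0" by linarith
  then show ?thesis by simp
qed

text \<open>Otherwise Fubini's theorem would give a segment in \<open>X\<close> along which the
  derivative vanishes almost everywhere. There \<open>p\<close> would be constant, so the segment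
  would lie on one ellipsoid, which is impossible.\<close>

lemma elliptical_deriv_not_AE_zero:
  fixes p :: "real^'n \<Rightarrow> real" and C :: "real^'n^'m"
  assumes p': "\<And>z. (p has_derivative p' z) (at z)"
    and inj: "\<And>x y. p x = p y \<Longrightarrow> norm (C *v (x - \<mu>)) = norm (C *v (y - \<mu>))"
    and C: "\<And>x. C *v x = 0 \<Longrightarrow> x = 0"
    and X: "open X" and AE0: "AE z in lborel. z \<in> X \<longrightarrow> (\<forall>v. p' z v = 0)"
  shows "X = {}"
proof (rule ccontr)
  assume "X \<noteq> {}"
  then obtain z0 r where r: "r > 0" "ball z0 r \<subseteq> X"
    using X open_contains_ball by blast
  obtain e :: "real^'n" where e: "norm e = 1"
    using vector_choose_size[of 1] by auto
  \<comment> \<open>Radius \<open>r/2\<close> leaves room in \<open>ball z0 r\<close> for segments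
    from \<open>z\<close> shorter than \<open>r/2\<close>.\<close>
  have "\<exists>z\<in>ball z0 (r/2). AE t in lborel. z + t *\<^sub>R e \<in> X \<longrightarrow> (\<forall>v. p' (z + t *\<^sub>R e) v = 0)"
  proof (rule ccontr)
    assume *: "\<not> ?thesis"
    have "AE z in lborel. z \<notin> ball z0 (r/2)"
      using AE_lborel_lines[OF AE0, of e] by eventually_elim (use * in auto)
    then have "ball z0 (r/2) \<in> null_sets lborel"
      by (subst AE_iff_null_sets) auto
    then have "negligible (ball z0 (r/2))"
      by (simp add: negligible_iff_null_sets null_sets_completionI)
    then show False
      using open_not_negligible[of "ball z0 (r/2)"] r(1) by simp
  qed
  then obtain z where z: "z \<in> ball z0 (r/2)"
    and AEz: "AE t in lborel. z + t *\<^sub>R e \<in> X \<longrightarrow> (\<forall>v. p' (z + t *\<^sub>R e) v = 0)"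
    by blast
  have D: "((\<lambda>s. p (z + s *\<^sub>R e)) has_real_derivative p' (z + t *\<^sub>R e) e) (at t)" for t
  proof -
    have "((\<lambda>s. p (z + s *\<^sub>R e)) has_derivative (\<lambda>s. p' (z + t *\<^sub>R e) (s *\<^sub>R e))) (at t)"
      by (rule has_derivative_compose[where g = p]) (auto intro!: derivative_eq_intros p')
    moreover have "p' (z + t *\<^sub>R e) (s *\<^sub>R e) = p' (z + t *\<^sub>R e) e * s" for s
      using p'[of "z + t *\<^sub>R e"] by (simp add: has_derivative_def bounded_linear.linear linear_scale)
    ultimately show ?thesis
      by (simp add: has_field_derivative_def mult_commute_abs)
  qed
  have const: "p (z + t *\<^sub>R e) = p (z + 0 *\<^sub>R e)" if t: "0 \<le> t" "t < r/2" for t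
  proof (rule AE_zero_deriv_imp_eq[OF D t(1), symmetric])
    have inX: "z + s *\<^sub>R e \<in> X" if "s \<in> {0..t}" for s
    proof -
      have "dist z0 (z + s *\<^sub>R e) \<le> dist z0 z + dist z (z + s *\<^sub>R e)"
        by (rule dist_triangle)
      also have "dist z (z + s *\<^sub>R e) = \<bar>s\<bar>"
        by (simp add: dist_norm e)
      finally show ?thesis
        using that t z r(2) by (auto simp: subset_iff)
    qed
    show "AE s in lborel. s \<in> {0..t} \<longrightarrow> p' (z + s *\<^sub>R e) e = 0"
      using AEz by eventually_elim (use inX in auto)
  qed
  \<comment> \<open>The parameters \<open>0\<close>, \<open>r/8\<close> and \<open>r/4\<close> lie
    below \<open>r/2\<close> and give three equally spaced points of one sphere.\<close>
  define x y where "x = C *v (z - \<mu>)" and "y = (r/8) *\<^sub>R (C *v e)"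
  have "C *v (z + t *\<^sub>R e - \<mu>) = x + t *\<^sub>R (C *v e)" for t
    by (simp add: x_def matrix_vector_mult_diff_distrib matrix_vector_right_distrib matrix_vector_mult_scaleR)
  then have line: "norm (x + t *\<^sub>R (C *v e)) = norm x" if "0 \<le> t" "t < r/2" for t
    using inj[OF const[OF that]] by (simp add: x_def)
  have "y = 0"
    using line[of "r/8"] line[of "r/4"] r(1)
    by (intro norm_eq_midpoint_imp_eq[of x]) (simp_all add: y_def)
  then show False
    using C[of e] r(1) e by (auto simp: y_def)
qed

text \<open>
  Pairing \<open>z\<close> with its mirror image \<open>\<sigma> z\<close>, the two values of the integrand add up to a
  nonpositive number, which vanishes only where \<open>p' z = 0\<close> or \<open>z\<close> and \<open>\<sigma> z\<close> lie on the
  same level set of \<open>q\<close>.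
\<close>

lemma elliptical_level_sets_symmetric:
  fixes p q :: "real^'n \<Rightarrow> real" and \<mu> \<nu> :: "real^'n" and C E R :: "real^'n^'n"
  defines "\<sigma> \<equiv> \<lambda>z. \<mu> + R *v (z - \<mu>)"
  assumes p': "\<And>z. (p has_derivative p' z) (at z)"
    and pos: "\<And>z. 0 < p z" "\<And>z. 0 < q z"
    and p_anti: "\<And>x y. norm (C *v (x - \<mu>)) < norm (C *v (y - \<mu>)) \<Longrightarrow> p y < p x"
    and p_level: "\<And>x y. norm (C *v (x - \<mu>)) = norm (C *v (y - \<mu>)) \<Longrightarrow> p x = p y"
    and q_anti: "\<And>x y. norm (E *v (x - \<nu>)) < norm (E *v (y - \<nu>)) \<Longrightarrow> q y < q x"
    and C: "\<And>x. C *v x = 0 \<Longrightarrow> x = 0"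
    and R: "R ** R = mat 1" "\<And>x. norm (C *v (R *v x)) = norm (C *v x)"
    and h: "\<And>a b. 0 < a \<Longrightarrow> a < b \<Longrightarrow> h a < h b"
    and V: "c > 0" "\<And>z. (C *v (z - \<mu>)) \<bullet> (C *v V z)
                = c * ((norm (E *v (z - \<nu>)))\<^sup>2 - (norm (E *v (\<sigma> z - \<nu>)))\<^sup>2)"
    and int: "has_bochner_integral lborel (\<lambda>z. h (p z / q z) * p' z (V z)) 0"
    and int_\<sigma>: "has_bochner_integral lborel (\<lambda>z. h (p (\<sigma> z) / q (\<sigma> z)) * p' (\<sigma> z) (V (\<sigma> z))) 0"
  shows "norm (E *v (z - \<nu>)) = norm (E *v (\<sigma> z - \<nu>))"
proof -
  have RR: "R *v (R *v x) = x" for x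
    by (simp add: matrix_vector_mul_assoc R(1))
  have \<sigma>\<sigma>: "\<sigma> (\<sigma> z) = z" for z
    by (simp add: \<sigma>_def RR)
  have C\<sigma>: "norm (C *v (\<sigma> z - \<mu>)) = norm (C *v (z - \<mu>))" for z
    by (simp add: \<sigma>_def R(2))
  have p\<sigma>: "p (\<sigma> z) = p z" for z
    by (rule p_level[OF C\<sigma>])
  have p_mono: "p y \<le> p x" if "norm (C *v (x - \<mu>)) \<le> norm (C *v (y - \<mu>))" for x y
    using that p_anti[of x y] p_level[of x y] by (cases "norm (C *v (x - \<mu>)) = norm (C *v (y - \<mu>))") auto
  have "\<exists>k\<le>0. \<forall>v. p' z v = k * ((C *v (z - \<mu>)) \<bullet> (C *v v))" for z
    using elliptical_gradient[OF p'[of z] p_mono C] by metis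
  then obtain k where k: "\<And>z. k z \<le> 0" "\<And>z v. p' z v = k z * ((C *v (z - \<mu>)) \<bullet> (C *v v))"
    by metis
  \<comment> \<open>Differentiate \<open>p \<circ> \<sigma> = p\<close> in direction
    \<open>z - \<mu>\<close>; the point \<open>\<mu>\<close> itself is fixed by
    \<open>\<sigma>\<close>.\<close>
  have k\<sigma>: "k (\<sigma> z) = k z" for z
  proof (cases "z = \<mu>")
    case False
    have lin_\<sigma>: "(\<sigma> has_derivative (*v) R) (at z)"
      unfolding \<sigma>_def by (auto intro!: derivative_eq_intros bounded_linear.has_derivative[of "(*v) R"])
    have "(p has_derivative (\<lambda>v. p' (\<sigma> z) (R *v v))) (at z)"
      using has_derivative_compose[OF lin_\<sigma> p'[of "\<sigma> z"]] by (simp add: p\<sigma>)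
    then have "p' z (z - \<mu>) = p' (\<sigma> z) (R *v (z - \<mu>))"
      using has_derivative_unique[OF p'[of z]] by metis
    then have "k z * (norm (C *v (z - \<mu>)))\<^sup>2 = k (\<sigma> z) * (norm (C *v (\<sigma> z - \<mu>)))\<^sup>2"
      unfolding k(2) by (simp add: \<sigma>_def power2_norm_eq_inner)
    moreover have "norm (C *v (z - \<mu>)) \<noteq> 0"
      using C[of "z - \<mu>"] False by auto
    ultimately show ?thesis by (simp add: C\<sigma>)
  qed (simp add: \<sigma>_def)
  define A where "A z = (norm (E *v (z - \<nu>)))\<^sup>2" for z
  \<comment> \<open>The sum of the integrand at \<open>z\<close> and at \<open>\<sigma> z\<close>:
    both share \<open>k\<close>, and since \<open>\<sigma>\<close> is an involution the differences
    of \<open>A\<close> are opposite.\<close>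
  define S where "S z = (h (p z / q z) - h (p z / q (\<sigma> z))) * (k z * (c * (A z - A (\<sigma> z))))" for z
  have "h (p z / q z) * p' z (V z) + h (p (\<sigma> z) / q (\<sigma> z)) * p' (\<sigma> z) (V (\<sigma> z)) = S z" for z
    unfolding k(2) V(2) k\<sigma> \<sigma>\<sigma> p\<sigma> S_def A_def by (simp add: algebra_simps)
  with has_bochner_integral_add[OF int int_\<sigma>]
  have S_int: "has_bochner_integral lborel S 0" by simp
  have mono: "h (p z / q x) < h (p z / q y)" if "A x < A y" for x y z
  proof (rule h)
    have "q y < q x"
      using that by (intro q_anti) (simp add: A_def power2_less_imp_less)
    then show "p z / q x < p z / q y"
      using pos by (simp add: divide_strict_left_mono)
  qed (use pos in simp)
  \<comment> \<open>The first factor of \<open>S z\<close> has the sign of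
    \<open>A z - A (\<sigma> z)\<close>, while \<open>c > 0\<close> and
    \<open>k z \<le> 0\<close>.\<close>
  have S_sign: "S z \<le> 0 \<and> (S z = 0 \<longrightarrow> k z = 0 \<or> A z = A (\<sigma> z))" for z
  proof -
    consider "A z = A (\<sigma> z)" | "k z = 0" | "k z < 0" "A z < A (\<sigma> z)" | "k z < 0" "A (\<sigma> z) < A z"
      using k(1)[of z] by fastforce
    then show ?thesis
    proof cases
      case 3
      then have "S z < 0"
        unfolding S_def using mono[of z "\<sigma> z" z] V(1)
        by (intro mult_neg_pos mult_neg_neg mult_pos_neg) auto
      then show ?thesis by simp
    next
      case 4
      then have "S z < 0"
        unfolding S_def using mono[of "\<sigma> z" z z] V(1)
        by (intro mult_pos_neg mult_neg_pos mult_pos_pos) auto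
      then show ?thesis by simp
    qed (simp_all add: S_def)
  qed
  have "AE z in lborel. - S z = 0"
    using S_int S_sign by (subst integral_nonneg_eq_0_iff_AE[symmetric]) (auto simp: has_bochner_integral_iff)
  then have "AE z in lborel. z \<in> {z. A z \<noteq> A (\<sigma> z)} \<longrightarrow> (\<forall>v. p' z v = 0)"
    by eventually_elim (use S_sign k(2) in auto)
  moreover have "open {z. A z \<noteq> A (\<sigma> z)}"
    unfolding A_def \<sigma>_def by (intro open_Collect_neq continuous_intros)
  moreover have "norm (C *v (x - \<mu>)) = norm (C *v (y - \<mu>))" if "p x = p y" for x y
    using p_anti[of x y] p_anti[of y x] that by (smt (verit))
  ultimately have "{z. A z \<noteq> A (\<sigma> z)} = {}"
    by (intro elliptical_deriv_not_AE_zero[OF p' _ C])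
  then show ?thesis
    by (auto simp: A_def)
qed

subsection \<open>Determinants and reflections\<close>

lemma has_derivative_matrix_entry:
  "((\<lambda>A::real^'n^'m. A $ i $ j) has_derivative (\<lambda>A. A $ i $ j)) F"
  by (intro bounded_linear_imp_has_derivative bounded_linear_compose[OF bounded_linear_vec_nth bounded_linear_vec_nth])

lemma differentiable_det:
  fixes A :: "real^'n^'n"
  shows "det differentiable (at A)"
proof -
  have "(\<lambda>A. of_int (sign \<pi>) * (\<Prod>i\<in>UNIV. A $ i $ \<pi> i)) differentiable (at A)"
    for \<pi> :: "'n \<Rightarrow> 'n"
    using has_derivative_prod[of UNIV "\<lambda>i A. A $ i $ \<pi> i" "\<lambda>i A. A $ i $ \<pi> i" A UNIV, OF has_derivative_matrix_entry]
    by (intro differentiable_mult differentiable_const) (auto simp: differentiable_def)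
  then show ?thesis
    unfolding det_def[abs_def] by (intro differentiable_sum) auto
qed

lemma differentiable_abs_det:
  fixes A :: "real^'n^'n"
  assumes "invertible A"
  shows "(\<lambda>A. \<bar>det A\<bar>) differentiable (at A)"
  using differentiable_compose[OF differentiable_norm_at differentiable_det, of A] assms
  by (simp add: invertible_det_nz)

lemma open_invertible: "open {A :: real^'n^'n. invertible A}"
proof -
  have "continuous_on UNIV (det :: real^'n^'n \<Rightarrow> real)"
    by (intro continuous_at_imp_continuous_on ballI differentiable_imp_continuous_within differentiable_det)
  then show ?thesis
    unfolding invertible_det_nz by (intro open_Collect_neq continuous_intros)
qed

lemma bounded_linear_matrix_vector_mult_left:
  "bounded_linear (\<lambda>A::real^'n^'m. A *v x)"
  unfolding linear_conv_bounded_linear[symmetric]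
  by (intro linearI) (simp_all add: matrix_vector_mult_add_rdistrib scaleR_matrix_vector_assoc)

lemmas matrix_vector_expand =
  matrix_vector_mul_assoc[symmetric] matrix_vector_mult_add_rdistrib matrix_vector_mult_diff_rdistrib
  scaleR_matrix_vector_assoc[symmetric] matrix_vector_mult_scaleR matrix_vector_right_distrib
  matrix_vector_mult_diff_distrib

text \<open>
  \<open>mat 1 + s Y\<close> is conjugate to \<open>mat 1 - s Y\<close>, so its determinant is even in \<open>s\<close>.
\<close>

lemma abs_det_line_stationary:
  fixes B R Y :: "real^'n^'n"
  assumes B: "invertible B" and R: "R ** R = mat 1" and RYR: "\<And>x. R *v (Y *v (R *v x)) = - (Y *v x)"
  shows "((\<lambda>s. \<bar>det (B + s *\<^sub>R (Y ** B))\<bar>) has_real_derivative 0) (at 0)"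
proof -
  obtain d where "((\<lambda>A. \<bar>det A\<bar>) has_derivative d) (at B)"
    using differentiable_abs_det[OF B] by (auto simp: differentiable_def)
  from has_real_derivative_along_line[OF this]
  have D: "((\<lambda>s. \<bar>det (B + s *\<^sub>R (Y ** B))\<bar>) has_real_derivative d (Y ** B)) (at 0)" .
  have "det R * det R = 1"
    using R by (metis det_I det_mul)
  have eq: "\<bar>det (B + s *\<^sub>R (Y ** B))\<bar> = \<bar>det (mat 1 + s *\<^sub>R Y)\<bar> * \<bar>det B\<bar>" for s
  proof -
    have "B + s *\<^sub>R (Y ** B) = (mat 1 + s *\<^sub>R Y) ** B"
      by (simp add: matrix_eq matrix_vector_expand)
    then show ?thesis by (simp add: det_mul abs_mult)
  qed
  have "det (mat 1 + s *\<^sub>R Y) = det (mat 1 + (- s) *\<^sub>R Y)" for s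
  proof -
    have "R *v (R *v x) = x" for x
      by (simp add: matrix_vector_mul_assoc R)
    then have "R ** (mat 1 + s *\<^sub>R Y) ** R = mat 1 + (- s) *\<^sub>R Y"
      by (simp add: matrix_eq matrix_vector_expand RYR)
    then have "det (mat 1 + (- s) *\<^sub>R Y) = det R * det (mat 1 + s *\<^sub>R Y) * det R"
      by (metis det_mul)
    then show ?thesis
      using \<open>det R * det R = 1\<close> by (simp add: mult.commute mult.left_commute)
  qed
  then have "d (Y ** B) = 0"
    by (intro even_has_real_derivative_0[OF D]) (simp only: eq)
  with D show ?thesis by simp
qed

text \<open>The reflection in the hyperplane orthogonal to \<open>b\<close>. For
  \<open>b = 0\<close> division by zero makes it the identity, so it is an involution for every
  \<open>b\<close>.\<close>

definition householder :: "real^'n \<Rightarrow> real^'n^'n" where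
  "householder b = mat 1 - (2 / (b \<bullet> b)) *\<^sub>R (\<chi> i j. b $ i * b $ j)"

lemma householder_mult: "householder b *v x = x - (2 * (b \<bullet> x) / (b \<bullet> b)) *\<^sub>R b"
proof -
  have "(\<chi> i j. b $ i * b $ j) *v x = (b \<bullet> x) *\<^sub>R b"
    by (simp add: vec_eq_iff matrix_vector_mult_def inner_vec_def sum_distrib_left ac_simps)
  then show ?thesis
    by (simp add: householder_def matrix_vector_expand)
qed

lemma transpose_householder: "transpose (householder b) = householder b"
  by (simp add: householder_def vec_eq_iff transpose_def mat_def mult.commute)

lemma householder_involution: "householder b ** householder b = mat 1"
proof -
  have "householder b *v (householder b *v x) = x" for x
  proof (cases "b = 0")
    case False
    then show ?thesis
      by (simp add: householder_mult inner_diff field_simps)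
  qed (simp add: householder_mult)
  then show ?thesis
    by (simp add: matrix_eq matrix_vector_expand)
qed

text \<open>If \<open>x\<close> and \<open>y\<close> have equal norm, the reflection belonging to
  \<open>x - y\<close> maps \<open>x\<close> to \<open>y\<close>. So \<open>norm (G *v x)\<close>
  depends on \<open>norm x\<close> only, and \<open>G\<close> is a multiple of an orthogonal
  matrix.\<close>

lemma norm_preserved_reflections_imp_conformal:
  fixes G :: "real^'n^'n"
  assumes G: "invertible G"
    and refl: "\<And>b x. norm (G *v (householder b *v x)) = norm (G *v x)"
  obtains c where "c > 0" "G ** transpose G = c *\<^sub>R mat 1"
proof -
  have level: "norm (G *v x) = norm (G *v y)" if "norm x = norm y" for x y
  proof (cases "x = y")
    case False
    have "x \<bullet> x = y \<bullet> y"
      using that by (simp add: norm_eq)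
    then have "2 * ((x - y) \<bullet> x) = (x - y) \<bullet> (x - y)"
      by (simp add: inner_diff inner_commute)
    then have "householder (x - y) *v x = y"
      using False by (simp add: householder_mult)
    then show ?thesis using refl by metis
  qed simp
  obtain e :: "real^'n" where e: "norm e = 1"
    using vector_choose_size[of 1] by auto
  define r where "r = norm (G *v e)"
  have "e \<noteq> 0" using e by auto
  then have r: "r > 0"
    by (simp add: r_def invertible_mult_eq_0_iff[OF G])
  have norm_G: "norm (G *v x) = r * norm x" for x
    using level[of x "norm x *\<^sub>R e"] by (simp add: e r_def matrix_vector_mult_scaleR)
  define Q where "Q = (1 / r) *\<^sub>R G"
  have "orthogonal_transformation ((*v) Q)"
    unfolding orthogonal_transformation
    using r by (simp add: Q_def norm_G flip: scaleR_matrix_vector_assoc)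
  then have "orthogonal_matrix Q"
    by (simp add: orthogonal_transformation_matrix)
  then have "Q ** transpose Q = mat 1"
    by (simp add: orthogonal_matrix_def)
  then have "(r *\<^sub>R Q) ** (r *\<^sub>R transpose Q) = (r * r) *\<^sub>R mat 1"
    by (simp add: matrix_eq matrix_vector_expand del: transpose_matrix_vector)
  moreover have "G = r *\<^sub>R Q"
    using r by (simp add: Q_def)
  ultimately have "G ** transpose G = (r * r) *\<^sub>R mat 1"
    by (simp add: transpose_scalar)
  with that[of "r * r"] r show thesis by simp
qed

lemma differentiable_mult_transpose_line:
  fixes B X :: "real^'n^'n"
  shows "(\<lambda>s. (B + s *\<^sub>R X) ** transpose (B + s *\<^sub>R X)) differentiable (at s within T)"
proof -
  have "(B + s *\<^sub>R X) ** transpose (B + s *\<^sub>R X)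
      = B ** transpose B + s *\<^sub>R (X ** transpose B + B ** transpose X) + (s * s) *\<^sub>R (X ** transpose X)" for s
    by (simp add: vec_eq_iff matrix_matrix_mult_def transpose_def algebra_simps sum.distrib sum_distrib_left)
  then show ?thesis
    by (simp add: differentiable_add differentiable_scaleR)
qed

subsection \<open>Stationarity as an integral identity\<close>

lemma abs_det_inverse:
  fixes B C :: "real^'n^'n"
  assumes "C ** B = mat 1"
  shows "\<bar>det C\<bar> = 1 / \<bar>det B\<bar>" "det B \<noteq> 0"
proof -
  have "det C * det B = 1"
    using assms by (metis det_I det_mul)
  then show "det B \<noteq> 0" by auto
  then show "\<bar>det C\<bar> = 1 / \<bar>det B\<bar>"
    using \<open>det C * det B = 1\<close> by (intro eq_divide_imp) (simp_all flip: abs_mult)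
qed

lemma invertible_obtain_inverse:
  fixes B :: "real^'n^'n"
  assumes "invertible B"
  obtains C where "C ** B = mat 1" "B ** C = mat 1" "invertible C"
  using assms unfolding invertible_def by blast

lemma radial_function_mult_transpose:
  fixes B C :: "real^'n^'n"
  assumes "radial_function p \<mu> (B ** transpose B) g" "C ** B = mat 1"
  shows "p z = g (norm (C *v (z - \<mu>))) * \<bar>det C\<bar>"
  using assms matrix_inv_transpose_mult[OF assms(2)] by (simp add: radial_function_def)

text \<open>Collects what differentiation under the integral rests on. The symmetry of
  \<open>p\<close> joins in the locale built on this one.\<close>

locale location_scale_divergence =
  fixes f :: "real \<Rightarrow> ereal"
    and p :: "real^'n \<Rightarrow> real"
    and q :: "real^'n \<Rightarrow> real^'n^'n \<Rightarrow> real^'n \<Rightarrow> real"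
    and g :: "real \<Rightarrow> real"
  assumes f_diff: "(\<lambda>u. real_of_ereal (f u)) differentiable_on {0<..}"
    and p_density: "prob_density p"
    and p_diff: "p differentiable_on UNIV"
    and family: "elliptical_location_scale_family q g"
    and f_div_finite: "\<And>\<nu> S. pos_def S \<Longrightarrow> finite_f_divergence f p (q \<nu> S)"
    and dominated: "locally_dominated_partials (reparam_integrand f p g)"
begin

lemma q_formula:
  assumes "C ** B = mat 1"
  shows "q \<nu> (B ** transpose B) z = g (norm (C *v (z - \<nu>))) * \<bar>det C\<bar>"
proof -
  have "invertible B"
    using assms matrix_left_right_inverse unfolding invertible_def by blast
  then have "pos_def (B ** transpose B)"
    by (rule pos_def_mult_transpose)
  then show ?thesis
    using family assms unfolding elliptical_location_scale_family_def
    by (blast intro: radial_function_mult_transpose)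
qed

lemma q_density:
  fixes B :: "real^'n^'n"
  assumes "invertible B"
  shows "prob_density (q \<nu> (B ** transpose B))"
  using family pos_def_mult_transpose[OF assms] by (auto simp: elliptical_location_scale_family_def)

text \<open>The normalization of all members of the family, read as a statement about the Jacobian
  of \<open>C\<close>. It is the hypothesis \<open>int\<close> of
  \<open>has_bochner_integral_lborel_affine\<close>.\<close>

lemma has_bochner_integral_radial:
  assumes C: "invertible C"
  shows "has_bochner_integral lborel (\<lambda>x :: real^'n. g (norm (C *v x)) * \<bar>det C\<bar>) 1"
proof -
  obtain B where B: "B ** C = mat 1" "C ** B = mat 1" "invertible B"
    using invertible_obtain_inverse[OF C] by blast
  have "q 0 (B ** transpose B) = (\<lambda>x. g (norm (C *v x)) * \<bar>det C\<bar>)"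
    using q_formula[OF B(2), of 0] by auto
  then show ?thesis
    using q_density[OF B(3), of 0] by (simp add: prob_density_def)
qed

lemma g_pos: "0 < g (norm (x :: real^'n))"
proof -
  have "mat 1 ** mat 1 = (mat 1 :: real^'n^'n)" by simp
  from q_formula[OF this, of 0 x] have "q 0 (mat 1) x = g (norm x)"
    by (simp add: transpose_mat)
  moreover have "invertible (mat 1 :: real^'n^'n)"
    unfolding invertible_def by (auto intro: exI[of _ "mat 1"])
  then have "0 < q 0 (mat 1) x"
    using q_density[of "mat 1" 0] by (simp add: prob_density_def transpose_mat)
  ultimately show ?thesis by simp
qed

lemma has_bochner_integral_affine:
  fixes T :: "real^'n^'n"
  assumes "invertible T" "has_bochner_integral lborel h I"
  shows "has_bochner_integral lborel (\<lambda>x. h (c + T *v x) * \<bar>det T\<bar>) I"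
  by (rule has_bochner_integral_lborel_affine[where \<phi> = "\<lambda>x. g (norm x)"])
    (simp_all add: assms has_bochner_integral_radial less_imp_le g_pos)

lemma p_pos: "0 < p z"
  using p_density by (simp add: prob_density_def)

text \<open>Substitute \<open>z = \<nu> + B *v \<zeta>\<close>. Outside \<open>f\<close> the
  Jacobian \<open>\<bar>det B\<bar>\<close> cancels the factor \<open>\<bar>det C\<bar>\<close> of
  the density; inside \<open>f\<close> that factor becomes \<open>\<bar>det B\<bar>\<close> in the
  numerator.\<close>

lemma has_bochner_integral_reparam:
  assumes B: "invertible B"
  shows "has_bochner_integral lborel (reparam_integrand f p g (\<nu>, B)) (f_divergence f p (q \<nu> (B ** transpose B)))"
proof -
  obtain C where C: "C ** B = mat 1"
    using invertible_obtain_inverse[OF B] by blast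
  have "has_bochner_integral lborel (f_div_integrand f p (q \<nu> (B ** transpose B)))
      (f_divergence f p (q \<nu> (B ** transpose B)))"
    using f_div_finite[OF pos_def_mult_transpose[OF B]]
    by (simp add: has_bochner_integral_iff finite_f_divergence_def f_divergence_def)
  from has_bochner_integral_affine[OF B this, of \<nu>]
  have "has_bochner_integral lborel
      (\<lambda>x. f_div_integrand f p (q \<nu> (B ** transpose B)) (\<nu> + B *v x) * \<bar>det B\<bar>)
      (f_divergence f p (q \<nu> (B ** transpose B)))" .
  moreover have "f_div_integrand f p (q \<nu> (B ** transpose B)) (\<nu> + B *v x) * \<bar>det B\<bar>
      = reparam_integrand f p g (\<nu>, B) x" for x
  proof -
    have q: "q \<nu> (B ** transpose B) (\<nu> + B *v x) = g (norm x) * \<bar>det C\<bar>"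
      by (simp add: q_formula[OF C] matrix_vector_mul_assoc C)
    show ?thesis
      using abs_det_inverse[OF C] unfolding f_div_integrand_def reparam_integrand_def q by simp
  qed
  ultimately show ?thesis by simp
qed

definition p' where "p' z = frechet_derivative p (at z)"

lemma p_has_derivative: "(p has_derivative p' z) (at z)"
  using p_diff by (simp add: p'_def differentiable_on_def flip: frechet_derivative_works)

definition f' where "f' = deriv (\<lambda>u. real_of_ereal (f u))"

lemma f_has_derivative:
  "0 < u \<Longrightarrow> ((\<lambda>u. real_of_ereal (f u)) has_real_derivative f' u) (at u)"
  using f_diff
  by (simp add: f'_def DERIV_deriv_iff_real_differentiable differentiable_on_eq_differentiable_at open_greaterThan)

lemma reparam_differentiable:
  assumes B: "invertible B"
  shows "(\<lambda>x. reparam_integrand f p g x \<zeta>) differentiable (at (\<nu>, B))"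
proof -
  have "(\<lambda>x. p (fst x + snd x *v \<zeta>)) differentiable (at (\<nu>, B))"
  proof (rule differentiable_compose[where f = p])
    show "p differentiable (at (fst (\<nu>, B) + snd (\<nu>, B) *v \<zeta>))"
      using p_has_derivative by (auto simp: differentiable_def)
    have "bounded_linear (\<lambda>x :: (real^'n) \<times> (real^'n^'n). fst x + snd x *v \<zeta>)"
      by (intro bounded_linear_add bounded_linear_fst
          bounded_linear_compose[OF bounded_linear_matrix_vector_mult_left bounded_linear_snd])
    then show "(\<lambda>x. fst x + snd x *v \<zeta>) differentiable (at (\<nu>, B))"
      by (rule bounded_linear_imp_differentiable)
  qed
  moreover have "(\<lambda>x :: (real^'n) \<times> (real^'n^'n). \<bar>det (snd x)\<bar>) differentiable (at (\<nu>, B))"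
    using differentiable_compose[of "\<lambda>A. \<bar>det A\<bar>" snd "(\<nu>, B)" UNIV] differentiable_abs_det[OF B]
      bounded_linear_imp_differentiable[OF bounded_linear_snd] by auto
  ultimately have u: "(\<lambda>x. p (fst x + snd x *v \<zeta>) * \<bar>det (snd x)\<bar> / g (norm \<zeta>)) differentiable (at (\<nu>, B))"
    using g_pos[of \<zeta>] by (intro differentiable_divide differentiable_mult differentiable_const) auto
  have "det B \<noteq> 0"
    using B by (simp add: invertible_det_nz)
  then have "(\<lambda>u. real_of_ereal (f u)) differentiable (at (p (\<nu> + B *v \<zeta>) * \<bar>det B\<bar> / g (norm \<zeta>)))"
    using p_pos g_pos by (intro differentiableI[OF has_field_derivative_imp_has_derivative, OF f_has_derivative]) simp
  then have "(\<lambda>x. real_of_ereal (f (p (fst x + snd x *v \<zeta>) * \<bar>det (snd x)\<bar> / g (norm \<zeta>)))) differentiable (at (\<nu>, B))"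
    by (intro differentiable_compose[OF _ u]) simp
  then show ?thesis
    unfolding reparam_integrand_def case_prod_beta
    by (intro differentiable_mult differentiable_const)
qed

text \<open>As \<open>\<bar>det\<bar>\<close> is stationary along \<open>X\<close>, only
  \<open>p\<close> contributes to the product rule, and \<open>g (norm \<zeta>)\<close> cancels
  against the denominator inside \<open>f\<close>.\<close>

lemma reparam_has_derivative:
  assumes B: "invertible B" and C: "C ** B = mat 1" "B ** C = mat 1"
    and det: "((\<lambda>s. \<bar>det (B + s *\<^sub>R X)\<bar>) has_real_derivative 0) (at 0)"
  shows "((\<lambda>s. reparam_integrand f p g ((\<nu>, B) + s *\<^sub>R (a, X)) \<zeta>) has_real_derivative
      f' (p (\<nu> + B *v \<zeta>) / q \<nu> (B ** transpose B) (\<nu> + B *v \<zeta>)) * p' (\<nu> + B *v \<zeta>) (a + X *v \<zeta>) * \<bar>det B\<bar>) (at 0)"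
proof -
  define z where "z = \<nu> + B *v \<zeta>"
  have q: "q \<nu> (B ** transpose B) z = g (norm \<zeta>) * \<bar>det C\<bar>"
    by (simp add: z_def q_formula[OF C(1)] matrix_vector_mul_assoc C(1))
  have u: "p z * \<bar>det B\<bar> / g (norm \<zeta>) = p z / q \<nu> (B ** transpose B) z"
    unfolding q abs_det_inverse(1)[OF C(1)] by simp
  have u_pos: "0 < p z / q \<nu> (B ** transpose B) z"
    using p_pos q_density[OF B, of \<nu>] by (simp add: prob_density_def)
  have "((\<lambda>s. p (z + s *\<^sub>R (a + X *v \<zeta>))) has_real_derivative p' z (a + X *v \<zeta>)) (at 0)"
    by (rule has_real_derivative_along_line[OF p_has_derivative])
  then have "((\<lambda>s. p (\<nu> + s *\<^sub>R a + (B + s *\<^sub>R X) *v \<zeta>)) has_real_derivative p' z (a + X *v \<zeta>)) (at 0)"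
    by (simp add: z_def matrix_vector_expand algebra_simps)
  from DERIV_cdivide[OF DERIV_mult[OF this det], of "g (norm \<zeta>)"]
  have "((\<lambda>s. p (\<nu> + s *\<^sub>R a + (B + s *\<^sub>R X) *v \<zeta>) * \<bar>det (B + s *\<^sub>R X)\<bar> / g (norm \<zeta>))
      has_real_derivative p' z (a + X *v \<zeta>) * \<bar>det B\<bar> / g (norm \<zeta>)) (at 0)"
    by simp
  then have "((\<lambda>s. real_of_ereal (f (p (\<nu> + s *\<^sub>R a + (B + s *\<^sub>R X) *v \<zeta>) * \<bar>det (B + s *\<^sub>R X)\<bar> / g (norm \<zeta>))))
      has_real_derivative f' (p z / q \<nu> (B ** transpose B) z) * (p' z (a + X *v \<zeta>) * \<bar>det B\<bar> / g (norm \<zeta>))) (at 0)"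
    by (intro DERIV_chain2[where f = "\<lambda>u. real_of_ereal (f u)"])
      (use f_has_derivative[OF u_pos] in \<open>simp_all add: z_def[symmetric] u\<close>)
  from DERIV_cmult_right[OF this, of "g (norm \<zeta>)"] show ?thesis
    using g_pos[of \<zeta>] by (simp add: reparam_integrand_def z_def mult.assoc)
qed

text \<open>Differentiate the reparametrized integral under the integral sign and return to
  \<open>z\<close> by \<open>\<zeta> = C *v (z - \<nu>)\<close>. The argument of \<open>p' z\<close>
  is the velocity with which the variation moves the point \<open>z\<close>.\<close>

lemma stationary_direction:
  assumes B: "invertible B" and C: "C ** B = mat 1" "B ** C = mat 1"
    and det: "((\<lambda>s. \<bar>det (B + s *\<^sub>R X)\<bar>) has_real_derivative 0) (at 0)"
    and stat: "((\<lambda>s. f_divergence f p (q (\<nu> + s *\<^sub>R a) ((B + s *\<^sub>R X) ** transpose (B + s *\<^sub>R X))))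
        has_real_derivative 0) (at 0)"
  shows "has_bochner_integral lborel
      (\<lambda>z. f' (p z / q \<nu> (B ** transpose B) z) * p' z (a + X *v (C *v (z - \<nu>)))) 0"
proof -
  let ?F = "reparam_integrand f p g"
  define D where "D \<zeta> = f' (p (\<nu> + B *v \<zeta>) / q \<nu> (B ** transpose B) (\<nu> + B *v \<zeta>))
      * p' (\<nu> + B *v \<zeta>) (a + X *v \<zeta>) * \<bar>det B\<bar>" for \<zeta>
  obtain U G where U: "open U" "(\<nu>, B) \<in> U" and G: "integrable lborel G"
    and bound: "AE \<zeta> in lborel. \<forall>x\<in>U. \<forall>b\<in>Basis. \<bar>deriv (\<lambda>t. ?F (x + t *\<^sub>R b) \<zeta>) 0\<bar> \<le> G \<zeta>"
    using dominated B unfolding locally_dominated_partials_def by blast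
  \<comment> \<open>On invertible matrices the integrand is integrable and differentiable in the
    parameters.\<close>
  define W where "W = U \<inter> (UNIV \<times> {A. invertible A})"
  have W: "open W" "(\<nu>, B) \<in> W"
    using U B by (auto simp: W_def intro!: open_Int open_Times open_invertible)
  have boundW: "AE \<zeta> in lborel. \<forall>x\<in>W. \<forall>b\<in>Basis. \<bar>deriv (\<lambda>t. ?F (x + t *\<^sub>R b) \<zeta>) 0\<bar> \<le> G \<zeta>"
    using bound by eventually_elim (auto simp: W_def)
  have int: "integrable lborel (?F x)" if "x \<in> W" for x
    using that has_bochner_integral_reparam[of "snd x" "fst x"] by (auto simp: W_def has_bochner_integral_iff)
  have diff: "(\<lambda>x. ?F x \<zeta>) differentiable (at x)" if "x \<in> W" for x \<zeta>
    using that reparam_differentiable[of "snd x" \<zeta> "fst x"] by (auto simp: W_def)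
  have der: "((\<lambda>s. ?F ((\<nu>, B) + s *\<^sub>R (a, X)) \<zeta>) has_real_derivative D \<zeta>) (at 0)" for \<zeta>
    unfolding D_def by (rule reparam_has_derivative[OF B C det])
  note leibniz = has_derivative_leibniz_directional[OF W G boundW int diff der]
  have "((\<lambda>s. (\<nu>, B) + s *\<^sub>R (a, X)) \<longlongrightarrow> (\<nu>, B) + 0 *\<^sub>R (a, X)) (at 0)"
    by (intro tendsto_intros)
  then have "eventually (\<lambda>s. (\<nu>, B) + s *\<^sub>R (a, X) \<in> W) (at 0)"
    using W by (intro topological_tendstoD) auto
  then have "eventually (\<lambda>s. (LINT \<zeta>|lborel. ?F ((\<nu>, B) + s *\<^sub>R (a, X)) \<zeta>)
      = f_divergence f p (q (\<nu> + s *\<^sub>R a) ((B + s *\<^sub>R X) ** transpose (B + s *\<^sub>R X)))) (at 0)"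
  proof eventually_elim
    case (elim s)
    then show ?case
      using has_bochner_integral_reparam[of "B + s *\<^sub>R X" "\<nu> + s *\<^sub>R a"]
      by (auto simp: W_def has_bochner_integral_iff)
  qed
  \<comment> \<open>Equality at \<open>s = 0\<close> turns the punctured neighbourhood into a full
    one, as \<open>DERIV_cong_ev\<close> requires.\<close>
  moreover have "(LINT \<zeta>|lborel. ?F ((\<nu>, B) + 0 *\<^sub>R (a, X)) \<zeta>)
      = f_divergence f p (q (\<nu> + 0 *\<^sub>R a) ((B + 0 *\<^sub>R X) ** transpose (B + 0 *\<^sub>R X)))"
    using has_bochner_integral_reparam[OF B, of \<nu>] by (simp add: has_bochner_integral_iff)
  ultimately have "eventually (\<lambda>s. (LINT \<zeta>|lborel. ?F ((\<nu>, B) + s *\<^sub>R (a, X)) \<zeta>)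
      = f_divergence f p (q (\<nu> + s *\<^sub>R a) ((B + s *\<^sub>R X) ** transpose (B + s *\<^sub>R X)))) (nhds 0)"
    by (simp add: eventually_nhds_conv_at)
  from DERIV_cong_ev[OF refl this refl] stat
  have "((\<lambda>s. LINT \<zeta>|lborel. ?F ((\<nu>, B) + s *\<^sub>R (a, X)) \<zeta>) has_real_derivative 0) (at 0)"
    by blast
  then have "(LINT \<zeta>|lborel. D \<zeta>) = 0"
    using leibniz(2) by (metis DERIV_unique)
  then have "has_bochner_integral lborel D 0"
    using leibniz(1) by (simp add: has_bochner_integral_iff)
  moreover have "invertible C"
    using C unfolding invertible_def by blast
  ultimately have "has_bochner_integral lborel (\<lambda>z. D (- (C *v \<nu>) + C *v z) * \<bar>det C\<bar>) 0"
    by (intro has_bochner_integral_affine)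
  moreover have "D (- (C *v \<nu>) + C *v z) * \<bar>det C\<bar>
      = f' (p z / q \<nu> (B ** transpose B) z) * p' z (a + X *v (C *v (z - \<nu>)))" for z
  proof -
    have 1: "- (C *v \<nu>) + C *v z = C *v (z - \<nu>)"
      by (simp add: matrix_vector_mult_diff_distrib)
    have 2: "\<nu> + B *v (C *v (z - \<nu>)) = z"
      by (simp add: matrix_vector_mul_assoc C)
    show ?thesis
      using abs_det_inverse[OF C(1)] unfolding 1 D_def 2 by simp
  qed
  ultimately show ?thesis by simp
qed

end

subsection \<open>Location and scale\<close>

lemma inner_transpose_mult:
  fixes A :: "real^'n^'m"
  shows "x \<bullet> (transpose A *v y) = (A *v x) \<bullet> y"
  by (metis dot_lmul_matrix inner_commute transpose_matrix_vector)

lemma matrix_vector_mult_uminus: "A *v (- x) = - (A *v x)" for A :: "real^'n^'m"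
  using matrix_vector_mult_diff_distrib[of A 0 x] by simp

text \<open>
  \<open>A\<close> is a square root of the scatter matrix of \<open>p\<close>; below, \<open>B\<close> is one of the scale
  parameter, and \<open>C\<close>, \<open>E\<close> are their inverses.
\<close>

locale elliptical_location_scale_divergence = location_scale_divergence f p q g
  for f and p :: "real^'n \<Rightarrow> real" and q g +
  fixes \<mu> :: "real^'n" and A C :: "real^'n^'n" and g\<^sub>p :: "real \<Rightarrow> real"
  assumes f: "f_generator f" "strictly_convex f"
    and g_anti: "strictly_unimodal g"
    and p_radial: "radial_function p \<mu> (A ** transpose A) g\<^sub>p"
    and g\<^sub>p_anti: "strictly_unimodal g\<^sub>p"
    and C: "C ** A = mat 1" "A ** C = mat 1"
begin

lemma CA: "C *v (A *v x) = x" and AC: "A *v (C *v x) = x"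
  by (simp_all add: matrix_vector_mul_assoc C)

text \<open>Feeds \<open>stationary_direction\<close> into
  \<open>elliptical_level_sets_symmetric\<close>. The reflected integral comes from the substitution
  of the affine involution, whose Jacobian has absolute value 1.\<close>

lemma level_sets_symmetric:
  fixes B E R :: "real^'n^'n"
  assumes B: "invertible B" and E: "E ** B = mat 1" "B ** E = mat 1"
    and R: "R ** R = mat 1" "\<And>x. norm (C *v (R *v x)) = norm (C *v x)"
    and V: "c > 0" "\<And>z. (C *v (z - \<mu>)) \<bullet> (C *v (a + X *v (E *v (z - \<nu>))))
        = c * ((norm (E *v (z - \<nu>)))\<^sup>2 - (norm (E *v (\<mu> + R *v (z - \<mu>) - \<nu>)))\<^sup>2)"
    and det: "((\<lambda>s. \<bar>det (B + s *\<^sub>R X)\<bar>) has_real_derivative 0) (at 0)"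
    and stat: "((\<lambda>s. f_divergence f p (q (\<nu> + s *\<^sub>R a) ((B + s *\<^sub>R X) ** transpose (B + s *\<^sub>R X))))
        has_real_derivative 0) (at 0)"
  shows "norm (E *v (z - \<nu>)) = norm (E *v (\<mu> + R *v (z - \<mu>) - \<nu>))"
proof -
  let ?q = "q \<nu> (B ** transpose B)"
  let ?H = "\<lambda>z. f' (p z / ?q z) * p' z (a + X *v (E *v (z - \<nu>)))"
  have p_eq: "p z = g\<^sub>p (norm (C *v (z - \<mu>))) * \<bar>det C\<bar>" for z
    by (rule radial_function_mult_transpose[OF p_radial C(1)])
  have q_eq: "?q z = g (norm (E *v (z - \<nu>))) * \<bar>det E\<bar>" for z
    by (rule q_formula[OF E(1)])
  have "0 < \<bar>det C\<bar>" "0 < \<bar>det E\<bar>"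
    using abs_det_inverse[OF C(1)] abs_det_inverse[OF E(1)] by simp_all
  note det_pos = this
  have H: "has_bochner_integral lborel ?H 0"
    by (rule stationary_direction[OF B E det stat])
  have "invertible R" "\<bar>det R\<bar> = 1"
  proof -
    show "invertible R"
      using R(1) unfolding invertible_def by blast
    have "\<bar>det R\<bar> * \<bar>det R\<bar> = 1"
      using R(1) by (metis abs_mult abs_one det_I det_mul)
    then show "\<bar>det R\<bar> = 1"
      by (auto simp: square_eq_1_iff simp flip: abs_mult)
  qed
  have "has_bochner_integral lborel (\<lambda>z. ?H (\<mu> + R *v (z - \<mu>))) 0"
  proof -
    have "has_bochner_integral lborel (\<lambda>z. ?H ((\<mu> - R *v \<mu>) + R *v z) * \<bar>det R\<bar>) 0"
      by (rule has_bochner_integral_affine[OF \<open>invertible R\<close> H])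
    moreover have "(\<mu> - R *v \<mu>) + R *v z = \<mu> + R *v (z - \<mu>)" for z
      by (simp add: matrix_vector_mult_diff_distrib)
    ultimately show ?thesis
      using \<open>\<bar>det R\<bar> = 1\<close> by simp
  qed
  note H_reflected = this
  show ?thesis
  proof (rule elliptical_level_sets_symmetric[where p = p and q = ?q and C = C and h = f' and p' = p'
        and V = "\<lambda>z. a + X *v (E *v (z - \<nu>))"])
    show "?q x > 0" for x
      using q_density[OF B, of \<nu>] by (simp add: prob_density_def)
    show "p y < p x" if "norm (C *v (x - \<mu>)) < norm (C *v (y - \<mu>))" for x y
      using g\<^sub>p_anti that det_pos
      by (simp add: p_eq strictly_unimodal_def monotone_on_def)
    show "?q y < ?q x" if "norm (E *v (x - \<nu>)) < norm (E *v (y - \<nu>))" for x y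
      using g_anti that det_pos
      by (simp add: q_eq strictly_unimodal_def monotone_on_def)
    show "p x = p y" if "norm (C *v (x - \<mu>)) = norm (C *v (y - \<mu>))" for x y
      using that by (simp add: p_eq)
    show "x = 0" if "C *v x = 0" for x
      using AC[of x] that by simp
    show "f' u < f' v" if "0 < u" "u < v" for u v
      unfolding f'_def by (rule strictly_convex_deriv_strict_mono[OF f f_diff that])
  qed (use p_has_derivative p_pos R V H H_reflected in auto)
qed

lemma stationary_location:
  fixes B E :: "real^'n^'n"
  assumes B: "invertible B" and E: "E ** B = mat 1" "B ** E = mat 1"
    and stat: "((\<lambda>\<nu>'. f_divergence f p (q \<nu>' (B ** transpose B))) has_derivative (\<lambda>_. 0)) (at \<nu>)"
  shows "\<nu> = \<mu>"
proof -
  have BE: "B *v (E *v x) = x" for x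
    by (simp add: matrix_vector_mul_assoc E)
  let ?R = "- mat 1 :: real^'n^'n"
  have R: "?R *v x = - x" for x
    using matrix_vector_mult_diff_rdistrib[of 0 "mat 1" x] by simp
  define \<delta> where "\<delta> = \<nu> - \<mu>"
  \<comment> \<open>This is \<open>-4\<close> times \<open>M\<close> applied to the inverse of
    \<open>S\<close> applied to \<open>\<delta>\<close>, where \<open>M = A ** transpose A\<close>
    and \<open>S = B ** transpose B\<close>. It makes the left side of the condition on the field
    equal to \<open>- 4 * ((E *v w) \<bullet> (E *v \<delta>))\<close>, which is the difference of
    squares by polarization.\<close>
  define a where "a = (- 4) *\<^sub>R (A *v (transpose A *v (transpose E *v (E *v \<delta>))))"
  \<comment> \<open>The symmetry is evaluated at \<open>z = \<nu>\<close>, where the left side is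
    0.\<close>
  have "norm (E *v (\<nu> - \<nu>)) = norm (E *v (\<mu> + ?R *v (\<nu> - \<mu>) - \<nu>))"
  proof (rule level_sets_symmetric[OF B E, where c = 1 and a = a and X = 0])
    show "?R ** ?R = mat 1"
      by (simp add: matrix_eq R flip: matrix_vector_mul_assoc)
    show "norm (C *v (?R *v x)) = norm (C *v x)" for x
      by (simp add: R matrix_vector_mult_uminus)
    show "(C *v (z - \<mu>)) \<bullet> (C *v (a + 0 *v (E *v (z - \<nu>))))
        = 1 * ((norm (E *v (z - \<nu>)))\<^sup>2 - (norm (E *v (\<mu> + ?R *v (z - \<mu>) - \<nu>)))\<^sup>2)" for z
    proof -
      define w where "w = z - \<mu>"
      have 1: "z - \<nu> = w - \<delta>" "\<mu> + ?R *v w - \<nu> = - w - \<delta>"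
        by (simp_all add: w_def \<delta>_def R)
      have "(C *v w) \<bullet> (C *v a) = - 4 * ((C *v w) \<bullet> (transpose A *v (transpose E *v (E *v \<delta>))))"
        by (simp add: a_def matrix_vector_mult_scaleR matrix_vector_mult_uminus CA del: transpose_matrix_vector)
      also have "\<dots> = - 4 * ((E *v w) \<bullet> (E *v \<delta>))"
        by (simp add: AC inner_transpose_mult del: transpose_matrix_vector)
      finally show ?thesis
        unfolding w_def[symmetric] 1
        by (simp add: matrix_vector_mult_diff_distrib matrix_vector_mult_uminus power2_norm_eq_inner inner_diff inner_commute)
    qed
    show "((\<lambda>s. \<bar>det (B + s *\<^sub>R 0)\<bar>) has_real_derivative 0) (at 0)"
      by simp
    show "((\<lambda>s. f_divergence f p (q (\<nu> + s *\<^sub>R a) ((B + s *\<^sub>R 0) ** transpose (B + s *\<^sub>R 0))))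
        has_real_derivative 0) (at 0)"
      using has_real_derivative_along_line[OF stat, of a] by simp
  qed simp
  then have "E *v (2 *\<^sub>R (\<mu> - \<nu>)) = 0"
    by (simp add: R scaleR_2 algebra_simps)
  then have "2 *\<^sub>R (\<mu> - \<nu>) = 0"
    using BE by (metis matrix_vector_mult_0_right)
  then show ?thesis by simp
qed

text \<open>The chain rule along the curve \<open>?S\<close>. Restricting to \<open>T\<close> keeps
  the curve among the positive definite matrices, where the derivative in \<open>S'\<close> is
  taken; as \<open>T\<close> is open, the restriction then drops out.\<close>

lemma scale_line_stationary:
  fixes B X :: "real^'n^'n"
  assumes B: "invertible B"
    and stat: "((\<lambda>S'. f_divergence f p (q \<nu> S')) has_derivative (\<lambda>_. 0)) (at (B ** transpose B) within {S'. pos_def S'})"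
  shows "((\<lambda>s. f_divergence f p (q \<nu> ((B + s *\<^sub>R X) ** transpose (B + s *\<^sub>R X)))) has_real_derivative 0) (at 0)"
proof -
  let ?S = "\<lambda>s. (B + s *\<^sub>R (X)) ** transpose (B + s *\<^sub>R (X))"
  define T where "T = {s. invertible (B + s *\<^sub>R (X))}"
  have "open T" "0 \<in> T"
  proof -
    have "T = (\<lambda>s. B + s *\<^sub>R (X)) -` {A. invertible A}"
      by (auto simp: T_def)
    then show "open T"
      by (simp only:) (intro open_vimage open_invertible continuous_intros)
    show "0 \<in> T" using B by (simp add: T_def)
  qed
  obtain S' where "(?S has_derivative S') (at 0 within T)"
    using differentiable_mult_transpose_line unfolding differentiable_def by blast
  moreover have "((\<lambda>S'. f_divergence f p (q \<nu> S')) has_derivative (\<lambda>_. 0)) (at (?S 0) within ?S ` T)"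
  proof (rule has_derivative_subset)
    show "((\<lambda>S'. f_divergence f p (q \<nu> S')) has_derivative (\<lambda>_. 0)) (at (?S 0) within {S'. pos_def S'})"
      using stat by simp
    show "?S ` T \<subseteq> {S'. pos_def S'}"
      by (auto simp: T_def intro!: pos_def_mult_transpose)
  qed
  ultimately have "((\<lambda>s. f_divergence f p (q \<nu> (?S s))) has_derivative (\<lambda>_. 0)) (at 0 within T)"
    using has_derivative_in_compose by fastforce
  then have "((\<lambda>s. f_divergence f p (q \<nu> (?S s))) has_derivative (\<lambda>_. 0)) (at 0)"
    using at_within_open[OF \<open>0 \<in> T\<close> \<open>open T\<close>] by simp
  then show ?thesis
    by (simp add: has_field_derivative_def lambda_zero)
qed

text \<open>Level-set symmetry for all reflections says that \<open>G = E ** A\<close> satisfies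
  \<open>norm (G *v (H *v x)) = norm (G *v x)\<close> for every Householder matrix \<open>H\<close>.
  So \<open>G\<close> is conformal, and \<open>A = B ** G\<close> gives the claim.\<close>

lemma stationary_scale:
  fixes B E :: "real^'n^'n"
  assumes B: "invertible B" and E: "E ** B = mat 1" "B ** E = mat 1"
    and stat: "((\<lambda>S'. f_divergence f p (q \<nu> S')) has_derivative (\<lambda>_. 0)) (at (B ** transpose B) within {S'. pos_def S'})"
    and \<nu>: "\<nu> = \<mu>"
  obtains c where "c > 0" "A ** transpose A = c *\<^sub>R (B ** transpose B)"
proof -
  have BE: "B *v (E *v x) = x" for x
    by (simp add: matrix_vector_mul_assoc E)
  have A: "invertible A"
    using C unfolding invertible_def by blast
  define G where "G = E ** A"
  have G: "invertible G"
    using A E unfolding G_def by (intro invertible_mult) (auto simp: invertible_def)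
  have "norm (G *v (householder b *v x)) = norm (G *v x)" for b x
  proof -
    define H where "H = householder b"
    have H: "transpose H = H" "H *v (H *v y) = y" for y
      by (simp_all add: H_def transpose_householder householder_involution matrix_vector_mul_assoc)
    \<comment> \<open>The quadratic form of \<open>K\<close> is the required difference of squares,
      and conjugation by \<open>H\<close> swaps its two terms, hence negates \<open>K\<close>.
      \<open>R\<close> and \<open>Y\<close> are \<open>H\<close> and \<open>K\<close> carried over
      by \<open>A\<close>, so \<open>R\<close> also negates \<open>Y\<close>, which makes the
      determinant stationary.\<close>
    define K where "K = transpose G ** G - H ** transpose G ** G ** H"
    define R where "R = A ** H ** C"
    define Y where "Y = A ** K ** C"
    have R: "R *v y = A *v (H *v (C *v y))" and Y: "Y *v y = A *v (K *v (C *v y))" for y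
      by (simp_all add: R_def Y_def matrix_vector_expand)
    have K: "K *v y = transpose G *v (G *v y) - H *v (transpose G *v (G *v (H *v y)))" for y
      by (simp add: K_def matrix_vector_expand del: transpose_matrix_vector)
    have KH: "H *v (K *v (H *v y)) = - (K *v y)" for y
      by (simp add: K H matrix_vector_expand del: transpose_matrix_vector)
    have H_inner: "y \<bullet> (H *v u) = (H *v y) \<bullet> u" for y u
      by (metis H(1) inner_transpose_mult)
    have H_orth: "norm (H *v y) = norm y" for y
      using H_inner[of "H *v y" y] by (simp add: H norm_eq)
    have RR: "R ** R = mat 1"
      by (simp add: matrix_eq R CA AC H flip: matrix_vector_mul_assoc)
    \<comment> \<open>The point \<open>A *v x + \<mu>\<close> is the one that \<open>C\<close> sends
      to \<open>x\<close> after centring at \<open>\<mu>\<close>.\<close>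
    have "norm (E *v (A *v x + \<mu> - \<nu>)) = norm (E *v (\<mu> + R *v (A *v x + \<mu> - \<mu>) - \<nu>))"
    proof (rule level_sets_symmetric[OF B E RR, where c = 1 and a = 0 and X = "Y ** B"])
      show "norm (C *v (R *v y)) = norm (C *v y)" for y
        by (simp add: R CA H_orth)
      show "(C *v (z - \<mu>)) \<bullet> (C *v (0 + (Y ** B) *v (E *v (z - \<nu>))))
          = 1 * ((norm (E *v (z - \<nu>)))\<^sup>2 - (norm (E *v (\<mu> + R *v (z - \<mu>) - \<nu>)))\<^sup>2)" for z
      proof -
        define y where "y = C *v (z - \<mu>)"
        have "C *v (0 + (Y ** B) *v (E *v (z - \<nu>))) = K *v y"
          by (simp add: Y BE CA y_def \<nu> flip: matrix_vector_mul_assoc)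
        moreover have "y \<bullet> (K *v y) = (norm (G *v y))\<^sup>2 - (norm (G *v (H *v y)))\<^sup>2"
          by (simp add: K inner_diff power2_norm_eq_inner inner_transpose_mult H_inner del: transpose_matrix_vector)
        moreover have "E *v (z - \<nu>) = G *v y" "E *v (\<mu> + R *v (z - \<mu>) - \<nu>) = G *v (H *v y)"
          by (simp_all add: G_def R y_def AC \<nu> flip: matrix_vector_mul_assoc)
        ultimately show ?thesis
          by (simp add: y_def)
      qed
      show "((\<lambda>s. \<bar>det (B + s *\<^sub>R (Y ** B))\<bar>) has_real_derivative 0) (at 0)"
      proof (rule abs_det_line_stationary[OF B RR])
        show "R *v (Y *v (R *v y)) = - (Y *v y)" for y
          by (simp add: R Y CA KH matrix_vector_mult_uminus)
      qed
      show "((\<lambda>s. f_divergence f p (q (\<nu> + s *\<^sub>R 0) ((B + s *\<^sub>R (Y ** B)) ** transpose (B + s *\<^sub>R (Y ** B)))))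
          has_real_derivative 0) (at 0)"
        using scale_line_stationary[OF B stat, of "Y ** B"] by simp
    qed simp
    then show ?thesis
      by (simp add: \<nu> R CA G_def H_def flip: matrix_vector_mul_assoc)
  qed
  from norm_preserved_reflections_imp_conformal[OF G this]
  obtain c where c: "c > 0" "G ** transpose G = c *\<^sub>R mat 1" by blast
  have "A = B ** G"
    by (simp add: G_def matrix_mul_assoc E)
  then have "A ** transpose A = B ** (G ** transpose G) ** transpose B"
    by (simp add: matrix_transpose_mul matrix_mul_assoc)
  also have "\<dots> = c *\<^sub>R (B ** transpose B)"
    by (simp add: c(2) matrix_eq matrix_vector_expand del: transpose_matrix_vector)
  finally show thesis
    using that c(1) by blast
qed

end

theorem theorem2:
  fixes f :: "real \<Rightarrow> ereal"
    and p :: "real^'n \<Rightarrow> real"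
    and q :: "real^'n \<Rightarrow> real^'n^'n \<Rightarrow> real^'n \<Rightarrow> real"
    and g\<^sub>p g\<^sub>q :: "real \<Rightarrow> real"
    and \<mu> \<nu> :: "real^'n"
    and M S :: "real^'n^'n"
  assumes "f_generator f"
    and "(\<lambda>u. real_of_ereal (f u)) differentiable_on {0<..}"
    and "strictly_convex f"
    and "prob_density p"
    and "elliptically_symmetric p \<mu> M"
    and "radial_function p \<mu> M g\<^sub>p"
    and "elliptical_location_scale_family q g\<^sub>q"
    and "strictly_unimodal g\<^sub>p"
    and "g\<^sub>p differentiable_on {0..}"
    and "strictly_decreasing_tail CARD('n) g\<^sub>p"
    and "strictly_unimodal g\<^sub>q"
    and "continuous_on {0..} g\<^sub>q"
    and "p differentiable_on UNIV"
    and "\<And>\<nu> S. pos_def S \<Longrightarrow> finite_f_divergence f p (q \<nu> S)"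
    and "locally_dominated_partials (reparam_integrand f p g\<^sub>q)"
    and "stationary_point (\<lambda>\<nu> S. f_divergence f p (q \<nu> S)) \<nu> S"
  shows "\<nu> = \<mu> \<and> (\<exists>\<gamma>>0. S = \<gamma>\<^sup>2 *\<^sub>R M)"
proof -
  have "pos_def M"
    using assms(5) by (simp add: elliptically_symmetric_def)
  then obtain A :: "real^'n^'n" where A: "invertible A" "M = A ** transpose A"
    using pos_def_factorization by metis
  obtain C where C: "C ** A = mat 1" "A ** C = mat 1"
    using invertible_obtain_inverse[OF A(1)] by blast
  interpret elliptical_location_scale_divergence f p q g\<^sub>q \<mu> A C g\<^sub>p
    by unfold_locales (use assms C A(2) in auto)
  have "pos_def S"
    and stat_loc: "((\<lambda>\<nu>'. f_divergence f p (q \<nu>' S)) has_derivative (\<lambda>_. 0)) (at \<nu>)"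
    and stat_scale: "((\<lambda>S'. f_divergence f p (q \<nu> S')) has_derivative (\<lambda>_. 0)) (at S within {S'. pos_def S'})"
    using assms(16) by (simp_all add: stationary_point_def)
  from this(1) obtain B :: "real^'n^'n" where B: "invertible B" "S = B ** transpose B"
    using pos_def_factorization by metis
  obtain E where E: "E ** B = mat 1" "B ** E = mat 1"
    using invertible_obtain_inverse[OF B(1)] by blast
  have \<nu>: "\<nu> = \<mu>"
    using stationary_location[OF B(1) E] stat_loc B(2) by simp
  obtain c where c: "c > 0" "M = c *\<^sub>R S"
    using stationary_scale[OF B(1) E _ \<nu>] stat_scale A(2) B(2) by metis
  \<comment> \<open>Since \<open>M = c *\<^sub>R S\<close>, the square of \<open>\<gamma>\<close>
    has to be \<open>1 / c\<close>.\<close>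
  have "S = (sqrt (1 / c))\<^sup>2 *\<^sub>R M" "0 < sqrt (1 / c)"
    using c by simp_all
  with \<nu> show ?thesis by blast
qed

end
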